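(* Let $n$ be an odd positive integer and let $r\geqslant 3$ be such that $2n-1<r$. Suppose that the planar $C^r$ system $\dot x=y+P(x,y)$, $\dot y=Q(x,y)$, with $j^1P(0)=j^1Q(0)=0$, has an isolated nilpotent monodromic singular point at the origin with Andreev number $n$. If the system satisfies the monodromy condition $\beta=n-1$, then the origin is a nilpotent focus.
   Context: $j^lG(0)$ denotes the $l$-jet of $G$ at $0$. For the system let $y=F(x)$ be the solution of $y+P(x,y)=0$ through the origin, $f(x)=Q(x,F(x))$, and $\Phi(x)=\left(\partial_xP+\partial_yQ\right)(x,F(x))$. Write $f(x)=ax^{\alpha}+O(x^{\alpha+1})$ with $a\ne0$ and $\Phi(x)=bx^\beta+O(x^{\beta+1})$ with $b\neq 0$ (if $\Phi$ has nonzero jet). The origin is monodromic (orbits turn around it, a first return map is defined) if and only if $a<0$, $\alpha=2n-1$ and either (i) $\beta>n-1$ or the jet of $\Phi$ vanishes, or (ii) $\beta=n-1$ and $b^2+4an<0$. The integer $n$ in $\alpha=2n-1$ is the Andreev number; "the monodromy condition $\beta=n-1$" is condition (ii). A focus is a singular point such that all nearby nonconstant orbits spiral towards it (in forward or in backward time). *)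

theory Defs
  imports "HOL-Analysis.Analysis" "HOL-Library.Landau_Symbols"
begin

section \<open>Regularity and jets\<close>

text \<open>
  Differentiability class \<open>C\<^sup>k\<close> on an open set; in finite dimension, continuity of all
  directional derivatives is the same as continuity of the derivative.
\<close>
primrec Ck_on :: "nat \<Rightarrow> ('a::real_normed_vector \<Rightarrow> 'b::real_normed_vector) \<Rightarrow> 'a set \<Rightarrow> bool" where
  "Ck_on 0 f S \<longleftrightarrow> continuous_on S f"
| "Ck_on (Suc k) f S \<longleftrightarrow> (\<forall>x\<in>S. f differentiable (at x)) \<and>
     (\<forall>v. Ck_on k (\<lambda>x. frechet_derivative f (at x) v) S)"

text \<open>The \<open>l\<close>-jet at \<open>p\<close>, represented by the Taylor polynomial in the increment \<open>v\<close>.\<close>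
definition jet :: "nat \<Rightarrow> ('a::real_normed_vector \<Rightarrow> 'b::real_normed_vector) \<Rightarrow> 'a \<Rightarrow> 'a \<Rightarrow> 'b" where
  "jet l f p = (\<lambda>v. \<Sum>k\<le>l. (((\<lambda>g x. frechet_derivative g (at x) v) ^^ k) f p) /\<^sub>R fact k)"

section \<open>Planar vector fields\<close>

text \<open>Vector fields are total functions, but only their values on the phase space \<open>U\<close> matter.\<close>

definition solves_on ::
  "(real \<times> real \<Rightarrow> real \<times> real) \<Rightarrow> (real \<times> real) set \<Rightarrow> (real \<Rightarrow> real \<times> real) \<Rightarrow> real set \<Rightarrow> bool" where
  "solves_on X U \<gamma> I \<longleftrightarrow>
     (\<forall>t\<in>I. \<gamma> t \<in> U \<and> (\<gamma> has_vector_derivative X (\<gamma> t)) (at t within I))"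

text \<open>\<open>\<theta>\<close> is a continuous choice of the polar angle of \<open>\<gamma>\<close> around \<open>z\<close>.\<close>
definition polar_angle_on ::
  "(real \<times> real) \<Rightarrow> (real \<Rightarrow> real \<times> real) \<Rightarrow> (real \<Rightarrow> real) \<Rightarrow> real set \<Rightarrow> bool" where
  "polar_angle_on z \<gamma> \<theta> I \<longleftrightarrow> continuous_on I \<theta> \<and>
     (\<forall>t\<in>I. \<gamma> t \<noteq> z \<and> \<gamma> t = z + norm (\<gamma> t - z) *\<^sub>R (cos (\<theta> t), sin (\<theta> t)))"

definition isolated_singular_point ::
  "(real \<times> real \<Rightarrow> real \<times> real) \<Rightarrow> real \<times> real \<Rightarrow> bool" where
  "isolated_singular_point X z \<longleftrightarrow> X z = 0 \<and> (\<forall>\<^sub>F p in at z. X p \<noteq> 0)"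

definition nilpotent_singular_point ::
  "(real \<times> real \<Rightarrow> real \<times> real) \<Rightarrow> real \<times> real \<Rightarrow> bool" where
  "nilpotent_singular_point X z \<longleftrightarrow> X z = 0 \<and>
     (\<exists>L. (X has_derivative L) (at z) \<and> L \<noteq> (\<lambda>_. 0) \<and> (\<exists>k. L ^^ k = (\<lambda>_. 0)))"

text \<open>
  Monodromic: the orbit of every point \<open>p\<close> near \<open>z\<close> makes a full turn around \<open>z\<close>, so that
  \<open>T\<close> is the time of first return, after a turn, to the ray from \<open>z\<close> through \<open>p\<close>.  The turn has
  to be small (inside an arbitrarily prescribed ball): otherwise a node could qualify
  because its orbits rotate around it only after having moved far away.
\<close>
definition monodromic ::
  "(real \<times> real \<Rightarrow> real \<times> real) \<Rightarrow> (real \<times> real) set \<Rightarrow> real \<times> real \<Rightarrow> bool" where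
  "monodromic X U z \<longleftrightarrow> (\<forall>\<epsilon>>0. \<exists>\<delta>>0. \<forall>p. p \<in> ball z \<delta> - {z} \<longrightarrow>
     (\<exists>\<gamma> \<theta> T. 0 < T \<and> solves_on X (U \<inter> ball z \<epsilon>) \<gamma> {0..T} \<and> \<gamma> 0 = p \<and>
        polar_angle_on z \<gamma> \<theta> {0..T} \<and> \<bar>\<theta> T - \<theta> 0\<bar> = 2 * pi \<and>
        (\<forall>t\<in>{0..<T}. \<bar>\<theta> t - \<theta> 0\<bar> < 2 * pi)))"

text \<open>
  The existential over \<open>\<gamma>\<close> speaks about the orbit of \<open>p\<close>, since solutions of a \<open>C\<^sup>1\<close> system are unique.
\<close>
definition spirals_towards ::
  "(real \<times> real \<Rightarrow> real \<times> real) \<Rightarrow> (real \<times> real) set \<Rightarrow> real \<times> real \<Rightarrow> real \<times> real \<Rightarrow> bool" where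
  "spirals_towards X U z p \<longleftrightarrow>
     (\<exists>\<gamma> \<theta>. solves_on X U \<gamma> {0..} \<and> \<gamma> 0 = p \<and> (\<gamma> \<longlongrightarrow> z) at_top \<and>
        polar_angle_on z \<gamma> \<theta> {0..} \<and> filterlim (\<lambda>t. \<bar>\<theta> t\<bar>) at_top at_top)"

text \<open>
  Either all nearby orbits spiral towards \<open>z\<close> in forward time, or all of them do so in backward
  time (forward time for \<open>- X\<close>).
\<close>
definition is_focus ::
  "(real \<times> real \<Rightarrow> real \<times> real) \<Rightarrow> (real \<times> real) set \<Rightarrow> real \<times> real \<Rightarrow> bool" where
  "is_focus X U z \<longleftrightarrow> X z = 0 \<and>
     (\<exists>\<delta>>0. (\<forall>p \<in> ball z \<delta> - {z}. spirals_towards X U z p) \<or>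
            (\<forall>p \<in> ball z \<delta> - {z}. spirals_towards (\<lambda>q. - X q) U z p))"

definition nilpotent_focus ::
  "(real \<times> real \<Rightarrow> real \<times> real) \<Rightarrow> (real \<times> real) set \<Rightarrow> real \<times> real \<Rightarrow> bool" where
  "nilpotent_focus X U z \<longleftrightarrow> nilpotent_singular_point X z \<and> is_focus X U z"

section \<open>Andreev data of a nilpotent system\<close>

definition nilpotent_system ::
  "(real \<times> real \<Rightarrow> real) \<Rightarrow> (real \<times> real \<Rightarrow> real) \<Rightarrow> real \<times> real \<Rightarrow> real \<times> real" where
  "nilpotent_system P Q = (\<lambda>(x, y). (y + P (x, y), Q (x, y)))"

text \<open>
  By the implicit function theorem these conditions determine the germ of \<open>F\<close> at \<open>0\<close>.
\<close>
definition nullcline_branch :: "(real \<times> real \<Rightarrow> real) \<Rightarrow> (real \<Rightarrow> real) \<Rightarrow> bool" where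
  "nullcline_branch P F \<longleftrightarrow>
     F 0 = 0 \<and> isCont F 0 \<and> (\<forall>\<^sub>F x in nhds 0. F x + P (x, F x) = 0)"

definition andreev_f :: "(real \<times> real \<Rightarrow> real) \<Rightarrow> (real \<Rightarrow> real) \<Rightarrow> real \<Rightarrow> real" where
  "andreev_f Q F x = Q (x, F x)"

definition andreev_Phi ::
  "(real \<times> real \<Rightarrow> real) \<Rightarrow> (real \<times> real \<Rightarrow> real) \<Rightarrow> (real \<Rightarrow> real) \<Rightarrow> real \<Rightarrow> real" where
  "andreev_Phi P Q F x = deriv (\<lambda>s. P (s, F x)) x + deriv (\<lambda>s. Q (x, s)) (F x)"

definition leading_term :: "(real \<Rightarrow> real) \<Rightarrow> real \<Rightarrow> nat \<Rightarrow> bool" where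
  "leading_term g c k \<longleftrightarrow> c \<noteq> 0 \<and> (\<lambda>x. g x - c * x ^ k) \<in> O[at 0](\<lambda>x. x ^ (k + 1))"

end

theory Submission
  imports Defs
begin

text \<open>
  Take \<open>u = y + P(x, y)\<close> as second coordinate, so that \<open>x' = u\<close> and, up to terms of higher quasi-homogeneous
  order, \<open>u' = a x\<^sup>2\<^sup>n\<^sup>-\<^sup>1 + b x\<^sup>n\<^sup>-\<^sup>1 u\<close>.  (With \<open>y - F(x)\<close> in place of \<open>u\<close> one would have to
  differentiate \<open>F\<close>.)  As \<open>n\<close> is odd, \<open>b x\<^sup>n\<^sup>-\<^sup>1\<close> has the sign of \<open>b\<close>, and the energy
  \<open>u\<^sup>2/2 - a x\<^sup>2\<^sup>n/(2n)\<close> changes at the rate \<open>b x\<^sup>n\<^sup>-\<^sup>1 u\<^sup>2\<close>.  This degenerates on both axes; adding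
  \<open>sgn b (K x u \<bar>u\<bar> - \<epsilon> x\<^sup>n u)\<close> yields a strict Lyapunov function \<open>V\<close> in forward time (\<open>b < 0\<close>)
  or in backward time (\<open>b > 0\<close>): the term with \<open>\<epsilon>\<close> contributes \<open>\<epsilon> \<bar>a\<bar> x\<^sup>3\<^sup>n\<^sup>-\<^sup>1\<close> and the one with \<open>K\<close>
  contributes \<open>K \<bar>u\<bar>\<^sup>3\<close>, which absorbs the remainder \<open>O(u\<^sup>2)\<close> of \<open>u'\<close> multiplied by \<open>u\<close>.

  Hence all nearby orbits tend to the origin in that time direction.  By monodromy each of them makes
  infinitely many full turns, and all turns have the same sense because \<open>x' = u > 0\<close> on the positive
  \<open>y\<close>-axis; so the polar angle diverges.
\<close>

section \<open>Solutions of Lipschitz equations\<close>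

text \<open>Give \<open>x\<close> weight 1 and \<open>u\<close> weight \<open>n\<close>: the two
  main terms of \<open>u'\<close> have weight \<open>2n-1\<close>, an error \<open>u^2\<close> has
  weight \<open>2n\<close>. In the energy rate this error becomes \<open>u^3\<close>, of higher
  weight than \<open>x^(n-1) u^2\<close> but not smaller than it near \<open>x = 0\<close>, where
  that rate vanishes. Counting weights therefore fails there, and the \<open>K\<close> term has to
  produce \<open>|u|^3\<close> itself. The derivative of \<open>x u |u|\<close> contains
  \<open>u^2 |u|\<close>, of fixed sign, whereas that of \<open>x u^2\<close> would contain the
  sign-changing \<open>u^3\<close>; and \<open>u |u|\<close> is still differentiable. The
  \<open>\<epsilon>\<close> term repairs the degeneracy at \<open>u = 0\<close>; its by-product
  \<open>n x^(n-1) u^2\<close> is paid for by the energy rate, so \<open>\<epsilon>\<close> must be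
  small against \<open>|b|\<close>. Convergence to the origin does not imply rotation, and
  \<open>monodromic\<close> supplies only one turn per starting point, along some local solution in
  forward time. Uniqueness identifies it with a piece of the orbit, also when the orbit converges in
  backward time. The value \<open>n = 1\<close> is contradictory: the 1-jets force
  \<open>\<Phi>(0) = 0\<close>, while \<open>\<beta> = 0\<close> would give the limit
  \<open>b \<noteq> 0\<close>. Hence \<open>n \<ge> 3\<close>.\<close>

lemma has_vector_derivative_integral_atLeast:
  fixes g :: "real \<Rightarrow> 'a::banach"
  assumes "continuous_on {0..} g" "0 \<le> t"
  shows "((\<lambda>u. integral {0..u} g) has_vector_derivative g t) (at t within {0..})"
proof -
  have "((\<lambda>u. integral {0..u} g) has_vector_derivative g t) (at t within {0..t+1})"
    using assms by (intro integral_has_vector_derivative) (auto intro: continuous_on_subset)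
  moreover have "at t within {0..t+1} = at t within {0..}"
    by (rule at_within_nhd[where S="{..<t+1}"]) auto
  ultimately show ?thesis by simp
qed

text \<open>Integrating against the weight \<open>exp (l * s)\<close> gains a factor
  \<open>1 / l\<close>. This makes the weighted Picard operator both bounded and
  contracting.\<close>

lemma norm_integral_le_exp:
  fixes g :: "real \<Rightarrow> 'a::banach"
  assumes "continuous_on {0..} g" "0 \<le> t" "0 < l" "0 \<le> M"
    and bound: "\<And>s. 0 \<le> s \<Longrightarrow> norm (g s) \<le> M * exp (l * s)"
  shows "norm (integral {0..t} g) \<le> M / l * exp (l * t)"
proof -
  have hi: "((\<lambda>s. M * exp (l * s)) has_integral (M / l * exp (l * t) - M / l * exp (l * 0))) {0..t}"
    using assms
    by (intro fundamental_theorem_of_calculus)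
       (auto intro!: derivative_eq_intros simp flip: has_real_derivative_iff_has_vector_derivative)
  have "norm (integral {0..t} g) \<le> integral {0..t} (\<lambda>s. M * exp (l * s))"
    using assms hi
    by (intro integral_norm_bound_integral)
       (auto intro!: integrable_continuous_real continuous_intros intro: continuous_on_subset)
  also have "\<dots> \<le> M / l * exp (l * t)"
    using integral_unique[OF hi] assms by simp
  finally show ?thesis .
qed

text \<open>
  The Picard operator, conjugated by the weight \<open>exp (2 * L * t)\<close>, is a contraction on bounded
  continuous functions of the whole half line, so that one fixed point gives a global solution.
\<close>
lemma lipschitz_ode_global_solution:
  fixes f :: "'a::banach \<Rightarrow> 'a"
  assumes lip: "\<And>x y. norm (f x - f y) \<le> L * norm (x - y)" and "L > 0"
  obtains \<gamma> where "\<gamma> 0 = p"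
    and "\<And>t. 0 \<le> t \<Longrightarrow> (\<gamma> has_vector_derivative f (\<gamma> t)) (at t within {0..})"
proof -
  \<comment> \<open>With this weight the contraction factor \<open>L / l\<close> equals
    \<open>1/2\<close>.\<close>
  define l where "l = 2 * L"
  have l: "l > 0" using \<open>L > 0\<close> by (simp add: l_def)
  have "L-lipschitz_on UNIV f"
    using lip \<open>L > 0\<close> by (intro lipschitz_onI) (auto simp: dist_norm)
  then have contf: "continuous_on UNIV f" by (rule lipschitz_on_continuous_on)
  \<comment> \<open>The unknown \<open>z\<close> encodes the solution as
    \<open>p + exp (l * t) *\<^sub>R z t\<close>. The type of bounded continuous functions lives on
    the whole line, so \<open>max 0 s\<close> freezes everything at negative times.\<close>
  define G where "G z s = f (p + exp (l * max 0 s) *\<^sub>R apply_bcontfun z s)"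
    for z :: "real \<Rightarrow>\<^sub>C 'a" and s :: real
  have contG: "continuous_on S (G z)" for z S
    unfolding G_def
    by (rule continuous_on_compose2[OF contf]) (auto intro!: continuous_intros)
  define T where "T z t = exp (- l * max 0 t) *\<^sub>R integral {0..max 0 t} (G z)"
    for z :: "real \<Rightarrow>\<^sub>C 'a" and t :: real
  have contI: "continuous_on {0..} (\<lambda>t. integral {0..t} (G z))" for z
    using has_vector_derivative_integral_atLeast[OF contG]
    by (auto simp: continuous_on_eq_continuous_within intro: has_vector_derivative_continuous)
  have contT: "continuous_on UNIV (T z)" for z
    unfolding T_def
    by (intro continuous_intros continuous_on_compose2[OF contI]) auto
  have boundT: "norm (T z t) \<le> (norm (f p) + L * norm z) / l" for z t
  proof -
    have "norm (G z s) \<le> (norm (f p) + L * norm z) * exp (l * s)" if "0 \<le> s" for s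
    proof -
      have "norm (G z s) \<le> norm (f p) + norm (G z s - f p)" by norm
      also have "norm (G z s - f p) \<le> L * norm (exp (l * s) *\<^sub>R apply_bcontfun z s)"
        using lip[of "p + exp (l * s) *\<^sub>R apply_bcontfun z s" p] that by (simp add: G_def)
      also have "\<dots> \<le> L * (exp (l * s) * norm z)"
        using norm_bounded[of z s] \<open>L > 0\<close> by (simp add: mult_left_mono)
      also have "norm (f p) \<le> norm (f p) * exp (l * s)"
        using that l by (simp add: mult_le_cancel_left1)
      finally show ?thesis by (simp add: algebra_simps)
    qed
    from norm_integral_le_exp[OF contG _ l _ this, of "max 0 t"]
    have "norm (integral {0..max 0 t} (G z)) \<le> (norm (f p) + L * norm z) / l * exp (l * max 0 t)"
      using \<open>L > 0\<close> by simp
    then show ?thesis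
      using l by (simp add: T_def exp_minus divide_simps)
  qed
  define TT where "TT z = Bcontfun (T z)" for z
  have TT: "apply_bcontfun (TT z) = T z" for z
    unfolding TT_def
    by (rule Bcontfun_inverse) (rule bcontfun_normI[OF contT boundT])
  have "dist (TT y) (TT z) \<le> 1/2 * dist y z" for y z
  proof (rule dist_bound)
    fix t :: real
    have "norm (G y s - G z s) \<le> L * dist y z * exp (l * s)" if "0 \<le> s" for s
    proof -
      have "norm (G y s - G z s) \<le> L * norm (exp (l * s) *\<^sub>R (apply_bcontfun y s - apply_bcontfun z s))"
        using lip[of "p + exp (l * s) *\<^sub>R apply_bcontfun y s" "p + exp (l * s) *\<^sub>R apply_bcontfun z s"] that
        by (simp add: G_def scaleR_diff_right)
      also have "\<dots> \<le> L * (exp (l * s) * dist y z)"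
        using dist_bounded[of y s z] \<open>L > 0\<close> by (simp add: dist_norm mult_left_mono)
      finally show ?thesis by (simp add: algebra_simps)
    qed
    from norm_integral_le_exp[OF continuous_on_diff[OF contG contG] _ l _ this, of "max 0 t"]
    have *: "norm (integral {0..max 0 t} (\<lambda>s. G y s - G z s)) \<le> L * dist y z / l * exp (l * max 0 t)"
      using \<open>L > 0\<close> by simp
    have "T y t - T z t = exp (- l * max 0 t) *\<^sub>R integral {0..max 0 t} (\<lambda>s. G y s - G z s)"
      unfolding T_def
      by (subst Henstock_Kurzweil_Integration.integral_diff)
         (auto intro!: integrable_continuous_real contG simp: scaleR_diff_right)
    then have "norm (T y t - T z t) \<le> L * dist y z / l"
      using * l by (simp add: exp_minus divide_simps)
    then show "dist (apply_bcontfun (TT y) t) (apply_bcontfun (TT z) t) \<le> 1/2 * dist y z"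
      using \<open>L > 0\<close> by (simp add: TT dist_norm l_def)
  qed
  then obtain z where "TT z = z"
    using banach_fix_type[of "1/2" TT] by auto
  then have z: "apply_bcontfun z t = T z t" for t
    using TT[of z] by simp
  define \<gamma> where "\<gamma> t = p + integral {0..t} (G z)" for t
  have G: "G z t = f (\<gamma> t)" if "0 \<le> t" for t
  proof -
    have "exp (l * t) *\<^sub>R apply_bcontfun z t = integral {0..t} (G z)"
      using that by (subst z) (simp add: T_def exp_minus)
    then show ?thesis using that by (subst G_def) (simp add: \<gamma>_def max.absorb2)
  qed
  show thesis
  proof
    show "\<gamma> 0 = p" by (simp add: \<gamma>_def)
    fix t :: real assume t: "0 \<le> t"
    have "((\<lambda>t. p + integral {0..t} (G z)) has_vector_derivative 0 + G z t) (at t within {0..})"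
      using t by (intro has_vector_derivative_add has_vector_derivative_integral_atLeast contG) auto
    then show "(\<gamma> has_vector_derivative f (\<gamma> t)) (at t within {0..})"
      using G[OF t] by (simp add: \<gamma>_def[abs_def])
  qed
qed

section \<open>Uniqueness of solutions and change of time\<close>

lemma has_vector_derivative_at_interior:
  assumes "(g has_vector_derivative d) (at t within S)" "t \<in> interior S"
  shows "(g has_vector_derivative d) (at t)"
  using assms at_within_interior by metis

lemma has_vector_derivative_imp_continuous_on:
  assumes "\<And>t. t \<in> S \<Longrightarrow> (g has_vector_derivative d t) (at t within S)"
  shows "continuous_on S g"
  using assms has_vector_derivative_continuous continuous_on_eq_continuous_within by blast

text \<open>Gronwall's argument: the squared distance of the two solutions, multiplied by
  \<open>exp (- (2 * L) * s)\<close>, does not increase and starts at 0. The Lipschitz bound is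
  asked only on a set \<open>B\<close> that contains both curves, since the vector field is
  controlled only near the origin.\<close>

lemma solutions_eq_on:
  fixes \<gamma> \<sigma> :: "real \<Rightarrow> 'a::real_inner"
  assumes lip: "\<And>p q. p \<in> B \<Longrightarrow> q \<in> B \<Longrightarrow> norm (Y p - Y q) \<le> L * norm (p - q)"
    and \<gamma>: "\<And>t. t \<in> {0..T} \<Longrightarrow> \<gamma> t \<in> B \<and> (\<gamma> has_vector_derivative Y (\<gamma> t)) (at t within {0..T})"
    and \<sigma>: "\<And>t. t \<in> {0..T} \<Longrightarrow> \<sigma> t \<in> B \<and> (\<sigma> has_vector_derivative Y (\<sigma> t)) (at t within {0..T})"
    and "\<gamma> 0 = \<sigma> 0" and t: "t \<in> {0..T}"
  shows "\<gamma> t = \<sigma> t"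
proof -
  define N where "N s = (\<gamma> s - \<sigma> s) \<bullet> (\<gamma> s - \<sigma> s)" for s
  have contN: "continuous_on {0..T} N"
    unfolding N_def using \<gamma> \<sigma>
    by (intro continuous_intros has_vector_derivative_imp_continuous_on) blast+
  have "exp (- (2 * L) * t) * N t \<le> exp (- (2 * L) * 0) * N 0"
  proof (rule DERIV_nonpos_imp_decreasing_open[where f = "\<lambda>s. exp (- (2 * L) * s) * N s"])
    show "continuous_on {0..t} (\<lambda>s. exp (- (2 * L) * s) * N s)"
      using t by (intro continuous_intros continuous_on_subset[OF contN]) auto
    fix s assume s: "0 < s" "s < t"
    then have s': "s \<in> {0..T}" "s \<in> interior {0..T}" using t by auto
    let ?d = "2 * ((Y (\<gamma> s) - Y (\<sigma> s)) \<bullet> (\<gamma> s - \<sigma> s))"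
    have dN: "(N has_real_derivative ?d) (at s)"
    proof -
      have "((\<lambda>s. \<gamma> s - \<sigma> s) has_derivative (\<lambda>h. h *\<^sub>R (Y (\<gamma> s) - Y (\<sigma> s)))) (at s)"
        using has_vector_derivative_at_interior[OF _ s'(2)]
          has_vector_derivative_diff[OF conjunct2[OF \<gamma>[OF s'(1)]] conjunct2[OF \<sigma>[OF s'(1)]]]
        unfolding has_vector_derivative_def by blast
      from has_derivative_inner[OF this this]
      show ?thesis
        unfolding N_def has_field_derivative_def
        by (rule has_derivative_eq_rhs) (auto simp: inner_commute)
    qed
    have "?d \<le> 2 * (L * norm (\<gamma> s - \<sigma> s) * norm (\<gamma> s - \<sigma> s))"
      using norm_cauchy_schwarz[of "Y (\<gamma> s) - Y (\<sigma> s)" "\<gamma> s - \<sigma> s"] lip[of "\<gamma> s" "\<sigma> s"] \<gamma>[OF s'(1)] \<sigma>[OF s'(1)]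
      by (smt (verit, best) mult_right_mono norm_ge_zero)
    also have "\<dots> = 2 * L * N s"
      by (simp add: N_def power2_norm_eq_inner[symmetric] power2_eq_square)
    finally have le: "?d \<le> 2 * L * N s" .
    have "((\<lambda>s. exp (- (2 * L) * s) * N s) has_real_derivative exp (- (2 * L) * s) * (?d - 2 * L * N s)) (at s)"
      by (rule derivative_eq_intros dN refl | simp)+ (simp add: algebra_simps)
    then show "\<exists>y. ((\<lambda>s. exp (- (2 * L) * s) * N s) has_real_derivative y) (at s) \<and> y \<le> 0"
      using le by (intro exI conjI) (auto simp: mult_nonneg_nonpos)
  qed (use t in auto)
  then have "N t \<le> 0"
    using \<open>\<gamma> 0 = \<sigma> 0\<close> by (simp add: N_def mult_le_0_iff)
  then show ?thesis
    by (simp add: N_def flip: power2_norm_eq_inner)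
qed

text \<open>With \<open>c = 1\<close> this restarts a solution at time \<open>r\<close>; with
  \<open>c = -1\<close> it runs the solution backward from there.\<close>

lemma has_vector_derivative_affine_time:
  fixes \<gamma> :: "real \<Rightarrow> 'a::real_normed_vector"
  assumes "(\<gamma> has_vector_derivative d) (at (r + c * t) within {0..})"
    and "\<And>s. s \<in> I \<Longrightarrow> 0 \<le> r + c * s"
  shows "((\<lambda>s. \<gamma> (r + c * s)) has_vector_derivative c *\<^sub>R d) (at t within I)"
proof -
  have "((\<lambda>s. r + c * s) has_vector_derivative c) (at t within I)"
    by (auto intro!: derivative_eq_intros simp flip: has_real_derivative_iff_has_vector_derivative)
  moreover have "(\<gamma> has_vector_derivative d) (at (r + c * t) within (\<lambda>s. r + c * s) ` I)"
    by (rule has_vector_derivative_within_subset[OF assms(1)]) (use assms(2) in auto)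
  ultimately show ?thesis
    using vector_diff_chain_within[of "\<lambda>s. r + c * s" c t I \<gamma> d] by (simp add: o_def)
qed

text \<open>Run backward from a zero at time \<open>t\<close>, the curve solves the equation of
  \<open>- Y\<close> with initial value 0. Uniqueness identifies it with the constant solution,
  which contradicts the starting point. This is what allows a polar angle along the whole
  orbit.\<close>

lemma solution_nonzero:
  fixes \<gamma> :: "real \<Rightarrow> 'a::real_inner"
  assumes lip: "\<And>p q. p \<in> cball 0 R \<Longrightarrow> q \<in> cball 0 R \<Longrightarrow> norm (Y p - Y q) \<le> L * norm (p - q)"
    and "0 \<le> R" "Y 0 = 0"
    and \<gamma>: "\<And>t. 0 \<le> t \<Longrightarrow> \<gamma> t \<in> cball 0 R \<and> (\<gamma> has_vector_derivative Y (\<gamma> t)) (at t within {0..})"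
    and "\<gamma> 0 \<noteq> 0" "0 \<le> t"
  shows "\<gamma> t \<noteq> 0"
proof
  assume "\<gamma> t = 0"
  have "\<gamma> (t + (-1) * t) = 0"
  proof (rule solutions_eq_on[where \<gamma> = "\<lambda>s. \<gamma> (t + (-1) * s)" and \<sigma> = "\<lambda>_. 0" and T = t
        and B = "cball 0 R" and Y = "\<lambda>p. - Y p" and L = L])
    show "norm (- Y p - - Y q) \<le> L * norm (p - q)" if "p \<in> cball 0 R" "q \<in> cball 0 R" for p q
      using lip[OF that] by (simp add: norm_minus_commute)
    fix s assume s: "s \<in> {0..t}"
    then have "((\<lambda>s. \<gamma> (t + (-1) * s)) has_vector_derivative (-1) *\<^sub>R Y (\<gamma> (t + (-1) * s))) (at s within {0..t})"
      by (intro has_vector_derivative_affine_time conjunct2[OF \<gamma>]) auto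
    then show "\<gamma> (t + (-1) * s) \<in> cball 0 R \<and>
        ((\<lambda>s. \<gamma> (t + (-1) * s)) has_vector_derivative - Y (\<gamma> (t + (-1) * s))) (at s within {0..t})"
      using \<gamma>[of "t + (-1) * s"] s by simp
  qed (use \<open>\<gamma> t = 0\<close> assms in auto)
  then show False using \<open>\<gamma> 0 \<noteq> 0\<close> by simp
qed

section \<open>Polar angles\<close>

text \<open>A convex set of times is contractible, so the curve, read in the punctured complex
  plane, has a continuous logarithm; its imaginary part is the angle.\<close>

lemma polar_angle_exists:
  fixes \<gamma> :: "real \<Rightarrow> real \<times> real"
  assumes "continuous_on I \<gamma>" "convex I" "\<And>t. t \<in> I \<Longrightarrow> \<gamma> t \<noteq> 0"
  obtains \<theta> where "polar_angle_on 0 \<gamma> \<theta> I"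
proof -
  let ?f = "\<lambda>t. Complex (fst (\<gamma> t)) (snd (\<gamma> t))"
  have "continuous_on I ?f"
    using assms(1) by (simp add: Complex_eq) (intro continuous_intros)
  moreover have "?f t \<noteq> 0" if "t \<in> I" for t
    using assms(3)[OF that] by (auto simp: complex_eq_iff prod_eq_iff)
  ultimately obtain g where g: "continuous_on I g" "\<And>t. t \<in> I \<Longrightarrow> ?f t = exp (g t)"
    using continuous_logarithm_on_contractible[of I ?f] assms(2) convex_imp_contractible by blast
  have "norm (\<gamma> t) = exp (Re (g t))" if "t \<in> I" for t
    using arg_cong[OF g(2)[OF that], of norm]
    by (simp add: norm_prod_def cmod_def flip: norm_exp_eq_Re)
  then have "\<gamma> t = norm (\<gamma> t) *\<^sub>R (cos (Im (g t)), sin (Im (g t)))" if "t \<in> I" for t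
    using g(2)[OF that] that by (simp add: prod_eq_iff complex_eq_iff Re_exp Im_exp)
  then have "polar_angle_on 0 \<gamma> (\<lambda>t. Im (g t)) I"
    using g(1) assms(3) unfolding polar_angle_on_def by (auto intro!: continuous_intros)
  then show thesis by (rule that)
qed

text \<open>Two angles of the same curve differ by a continuous function with values in the
  multiples of \<open>2 * pi\<close>, which is constant. The full turn measured by the angle that
  comes with \<open>monodromic\<close> is thereby a full turn of any other angle.\<close>

lemma polar_angle_diff_eq:
  assumes \<theta>: "polar_angle_on z \<gamma> \<theta> {a..b}" and \<phi>: "polar_angle_on z \<gamma> \<phi> {a..b}" and "a \<le> b"
  shows "\<theta> b - \<theta> a = \<phi> b - \<phi> a"
proof -
  have cs: "cos (\<theta> t) = cos (\<phi> t) \<and> sin (\<theta> t) = sin (\<phi> t)" if "t \<in> {a..b}" for t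
  proof -
    have "\<gamma> t \<noteq> z" and
      "norm (\<gamma> t - z) *\<^sub>R (cos (\<theta> t), sin (\<theta> t)) = norm (\<gamma> t - z) *\<^sub>R (cos (\<phi> t), sin (\<phi> t))"
      using \<theta> \<phi> that unfolding polar_angle_on_def by (metis, metis add_left_cancel)
    then show ?thesis by simp
  qed
  have disc: "\<exists>k::int. \<theta> t - \<phi> t = 2 * pi * k" if "t \<in> {a..b}" for t
    using cs[OF that] sin_cos_eq_iff[of "\<theta> t" "\<phi> t"] by force
  have "(\<lambda>t. \<theta> t - \<phi> t) constant_on {a..b}"
  proof (rule continuous_discrete_range_constant)
    show "continuous_on {a..b} (\<lambda>t. \<theta> t - \<phi> t)"
      using \<theta> \<phi> by (auto simp: polar_angle_on_def intro: continuous_intros)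
    fix t assume t: "t \<in> {a..b}"
    have "2 * pi \<le> norm ((\<theta> s - \<phi> s) - (\<theta> t - \<phi> t))"
      if s: "s \<in> {a..b}" "\<theta> s - \<phi> s \<noteq> \<theta> t - \<phi> t" for s
    proof -
      obtain j k :: int where jk: "\<theta> s - \<phi> s = 2 * pi * j" "\<theta> t - \<phi> t = 2 * pi * k"
        using disc s t by metis
      then have "j \<noteq> k" using s by auto
      then have "1 \<le> \<bar>real_of_int (j - k)\<bar>" by linarith
      then have "2 * pi * 1 \<le> 2 * pi * \<bar>real_of_int (j - k)\<bar>" by (intro mult_left_mono) auto
      also have "\<dots> = \<bar>2 * pi * j - 2 * pi * k\<bar>"
        by (simp add: abs_mult flip: right_diff_distrib)
      finally show ?thesis using jk by simp
    qed
    then show "\<exists>e>0. \<forall>s. s \<in> {a..b} \<and> \<theta> s - \<phi> s \<noteq> \<theta> t - \<phi> t \<longrightarrow>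
        e \<le> norm ((\<theta> s - \<phi> s) - (\<theta> t - \<phi> t))"
      by (intro exI[of _ "2 * pi"]) auto
  qed auto
  then obtain c where "\<And>t. t \<in> {a..b} \<Longrightarrow> \<theta> t - \<phi> t = c"
    unfolding constant_on_def by blast
  from this[of a] this[of b] \<open>a \<le> b\<close> show ?thesis by simp
qed

text \<open>
  A ray that is crossed in one direction only is a barrier for the angle \<open>g\<close>; here \<open>h\<close> is the
  signed distance from the line carrying the ray.
\<close>
lemma angle_barrier:
  fixes g h \<rho> :: "real \<Rightarrow> real" and k :: int
  assumes contg: "continuous_on {0..} g"
    and h: "\<And>t. 0 \<le> t \<Longrightarrow> h t = \<rho> t * sin (g t) \<and> 0 < \<rho> t"
    and cross: "\<And>t. 0 \<le> t \<Longrightarrow> sin (g t) = 0 \<Longrightarrow> cos (g t) = 1 \<Longrightarrow>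
      \<exists>d<0. (h has_real_derivative d) (at t within {0..})"
    and "0 \<le> r" "r \<le> t" "g r \<le> 2 * pi * k"
  shows "g t \<le> 2 * pi * k"
proof (rule ccontr)
  assume "\<not> ?thesis"
  then have gt: "g t > 2 * pi * k" by simp
  \<comment> \<open>The supremum \<open>u\<close> of \<open>S\<close> is the last time up to
    \<open>t\<close> at which the angle is still at or below the ray; there the angle equals
    \<open>2 * pi * k\<close> and afterwards it lies above.\<close>
  define S where "S = {r..t} \<inter> g -` {..2 * pi * k}"
  have contrt: "continuous_on {r..t} g"
    by (rule continuous_on_subset[OF contg]) (use \<open>0 \<le> r\<close> in auto)
  have "closed S"
    unfolding S_def by (rule continuous_closed_preimage[OF contrt]) auto
  moreover have "S \<noteq> {}" "bdd_above S" using assms by (auto simp: S_def)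
  ultimately have "Sup S \<in> S" by (rule closed_contains_Sup[rotated 2])
  define u where "u = Sup S"
  have u: "r \<le> u" "u \<le> t" "g u \<le> 2 * pi * k" using \<open>Sup S \<in> S\<close> by (auto simp: S_def u_def)
  have above: "g s > 2 * pi * k" if "u < s" "s \<le> t" for s
  proof (rule ccontr)
    assume "\<not> g s > 2 * pi * k"
    then have "s \<in> S" using that u by (auto simp: S_def)
    then have "s \<le> u" unfolding u_def using \<open>bdd_above S\<close> by (rule cSup_upper)
    with that show False by simp
  qed
  have "u < t" using gt u by (cases "u = t") auto
  have "\<exists>s. u \<le> s \<and> s \<le> t \<and> g s = 2 * pi * k"
    using u gt by (intro IVT' continuous_on_subset[OF contrt]) auto
  then obtain s where "u \<le> s" "s \<le> t" "g s = 2 * pi * k" by blast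
  then have gu: "g u = 2 * pi * k"
    using above[of s] by (cases "u = s") auto
  then have "sin (g u) = 0" "cos (g u) = 1"
    using sin_cos_eq_iff[of "g u" 0] by auto
  moreover from u \<open>0 \<le> r\<close> have "0 \<le> u" by simp
  ultimately obtain d where "d < 0" "(h has_real_derivative d) (at u within {0..})"
    using cross by blast
  \<comment> \<open>Just after \<open>u\<close> the distance \<open>h\<close> is negative, but the
    angle is then strictly between \<open>2 * pi * k\<close> and \<open>2 * pi * k + pi\<close>,
    where the sine, hence \<open>h\<close>, is positive.\<close>
  then obtain e where e: "e > 0" "\<And>s. 0 < s \<Longrightarrow> s < e \<Longrightarrow> h (u + s) < h u"
    using has_real_derivative_neg_dec_right[of h d u "{0..}"] \<open>0 \<le> u\<close> by auto
  have hu: "h u = 0" using h[OF \<open>0 \<le> u\<close>] \<open>sin (g u) = 0\<close> by simp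
  have "continuous (at u within {0..}) g"
    using contg \<open>0 \<le> u\<close> by (auto simp: continuous_on_eq_continuous_within)
  then obtain e' where e': "e' > 0" "\<And>s. 0 \<le> s \<Longrightarrow> dist s u < e' \<Longrightarrow> dist (g s) (g u) < pi"
    unfolding continuous_within_eps_delta by (auto dest!: spec[of _ pi])
  define s where "s = Min {e, e', t - u} / 2"
  have s: "0 < s" "s < e" "s < e'" "u + s \<le> t"
    using e e' \<open>u < t\<close> by (auto simp: s_def min_def field_simps)
  have "g (u + s) < 2 * pi * k + pi"
    using e'(2)[of "u + s"] s \<open>0 \<le> u\<close> gu by (auto simp: dist_real_def)
  moreover have "g (u + s) > 2 * pi * k" using above s by simp
  ultimately have "sin (g (u + s) - 2 * pi * k) > 0" by (intro sin_gt_zero) auto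
  moreover have "sin (g (u + s) - 2 * pi * k) = sin (g (u + s))"
    using sin_cos_eq_iff[of "g (u + s)" "g (u + s) - 2 * pi * k"] by force
  ultimately have "h (u + s) > 0" using h[of "u + s"] s \<open>0 \<le> u\<close> by simp
  with e(2)[of s] s hu show False by simp
qed

text \<open>Any interval \<open>[x, x + 2 * pi)\<close> contains a multiple of
  \<open>2 * pi\<close>, so a positive full turn would have to pass a barrier upward. Every full
  turn is thus negative; it brings the angle below the next lower barrier, which it never passes
  again.\<close>

lemma angle_at_bot:
  fixes g h \<rho> :: "real \<Rightarrow> real"
  assumes contg: "continuous_on {0..} g"
    and h: "\<And>t. 0 \<le> t \<Longrightarrow> h t = \<rho> t * sin (g t) \<and> 0 < \<rho> t"
    and cross: "\<And>t. 0 \<le> t \<Longrightarrow> sin (g t) = 0 \<Longrightarrow> cos (g t) = 1 \<Longrightarrow>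
      \<exists>d<0. (h has_real_derivative d) (at t within {0..})"
    and turn: "\<And>t. 0 \<le> t \<Longrightarrow> \<exists>r\<ge>t. \<exists>s\<ge>r. \<bar>g s - g r\<bar> = 2 * pi"
  shows "filterlim g at_bot at_top"
proof -
  have barrier: "g s \<le> 2 * pi * k" if "0 \<le> r" "r \<le> s" "g r \<le> 2 * pi * k" for r s and k :: int
    by (rule angle_barrier[OF contg, of h \<rho>]) (fact h, fact cross, fact that(1), fact that(2), fact that(3))
  have ceil: "x \<le> 2 * pi * \<lceil>x / (2 * pi)\<rceil>" for x :: real
  proof -
    have "x / (2 * pi) \<le> \<lceil>x / (2 * pi)\<rceil>" by (rule le_of_int_ceiling)
    then have "x \<le> \<lceil>x / (2 * pi)\<rceil> * (2 * pi)" by (subst (asm) pos_divide_le_eq) auto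
    then show ?thesis by (simp only: mult.commute)
  qed
  \<comment> \<open>\<open>turn\<close> gives no sign, so a turn by \<open>+ 2 * pi\<close> is
    excluded separately, by the barrier at the first multiple of \<open>2 * pi\<close> not below
    \<open>g r\<close>.\<close>
  have drop: "\<exists>s\<ge>t. g s \<le> 2 * pi * real_of_int (k - 1)" if "0 \<le> t" "g t \<le> 2 * pi * k" for t and k :: int
  proof -
    obtain r s where rs: "t \<le> r" "r \<le> s" "\<bar>g s - g r\<bar> = 2 * pi"
      using turn[OF \<open>0 \<le> t\<close>] by blast
    have "g r \<le> 2 * pi * k" by (rule barrier[of t r k]) (use that rs in auto)
    moreover have "g s - g r \<noteq> 2 * pi"
    proof
      assume eq: "g s - g r = 2 * pi"
      have "g r \<le> 2 * pi * \<lceil>g r / (2 * pi)\<rceil>"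
        by (rule ceil)
      then have "g s \<le> 2 * pi * \<lceil>g r / (2 * pi)\<rceil>"
        by (rule barrier[rotated 2]) (use that rs in linarith)+
      also have "\<dots> < 2 * pi * (g r / (2 * pi) + 1)"
        by (rule mult_strict_left_mono) (use ceiling_correct[of "g r / (2 * pi)"] in auto)
      also have "\<dots> = g r + 2 * pi" by (simp add: field_simps)
      finally show False using eq by simp
    qed
    moreover have "g s - g r = 2 * pi \<or> g s - g r = - (2 * pi)"
      using rs(3) by (auto simp: abs_if split: if_splits)
    ultimately have "g s \<le> 2 * pi * k - 2 * pi" by linarith
    then have "g s \<le> 2 * pi * real_of_int (k - 1)"
      by (simp add: right_diff_distrib)
    then show ?thesis using rs by (intro exI[of _ s]) auto
  qed
  define K where "K = \<lceil>g 0 / (2 * pi)\<rceil>"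
  have K: "g 0 \<le> 2 * pi * K"
    unfolding K_def by (rule ceil)
  have reach: "\<exists>t\<ge>0. g t \<le> 2 * pi * real_of_int (K - int j)" for j
  proof (induction j)
    case 0
    then show ?case using K by auto
  next
    case (Suc j)
    then obtain t where "0 \<le> t" "g t \<le> 2 * pi * real_of_int (K - int j)" by blast
    from drop[OF this] obtain s where "t \<le> s" "g s \<le> 2 * pi * real_of_int (K - int j - 1)" by blast
    moreover have "K - int j - 1 = K - int (Suc j)" by simp
    ultimately have "0 \<le> s" "g s \<le> 2 * pi * real_of_int (K - int (Suc j))"
      using \<open>0 \<le> t\<close> by (linarith, simp only:)
    then show ?case by blast
  qed
  show ?thesis
    unfolding filterlim_at_bot
  proof
    fix Z :: real
    obtain j :: nat where "K - Z / (2 * pi) < j" using reals_Archimedean2 by blast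
    then have "2 * pi * real_of_int (K - int j) \<le> 2 * pi * (Z / (2 * pi))"
      by (intro mult_left_mono) auto
    then have "2 * pi * real_of_int (K - int j) \<le> Z" by simp
    moreover obtain t where t: "0 \<le> t" "g t \<le> 2 * pi * real_of_int (K - int j)" using reach[of j] by blast
    ultimately have "g s \<le> Z" if "t \<le> s" for s
      using barrier[OF t(1) that t(2)] by linarith
    then show "\<forall>\<^sub>F s in at_top. g s \<le> Z"
      by (auto simp: eventually_at_top_linorder)
  qed
qed

section \<open>From monodromy to spiralling\<close>

text \<open>
  For \<open>c = -1\<close> the curve runs backward along an orbit: the turn that starts at a late
  point of \<open>\<gamma>\<close>, being smaller than \<open>norm (\<gamma> t)\<close>, ends before the orbit is back at \<open>\<gamma> t\<close>.
\<close>
lemma monodromic_turn: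
  assumes mono: "monodromic X U 0"
    and lip: "\<And>p q. p \<in> cball 0 R \<Longrightarrow> q \<in> cball 0 R \<Longrightarrow> norm (X p - X q) \<le> L * norm (p - q)"
    and "0 < R" and c: "c = 1 \<or> c = (-1::real)"
    and \<gamma>: "\<And>t. 0 \<le> t \<Longrightarrow> \<gamma> t \<in> cball 0 R \<and> (\<gamma> has_vector_derivative c *\<^sub>R X (\<gamma> t)) (at t within {0..})"
    and lim: "(\<gamma> \<longlongrightarrow> 0) at_top" and pol: "polar_angle_on 0 \<gamma> \<theta> {0..}" and "0 \<le> t"
  shows "\<exists>r\<ge>t. \<exists>s\<ge>r. \<bar>\<theta> s - \<theta> r\<bar> = 2 * pi"
proof -
  have nz: "\<gamma> s \<noteq> 0" if "0 \<le> s" for s using pol that by (auto simp: polar_angle_on_def)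
  \<comment> \<open>The bound \<open>R\<close> keeps the turn where \<open>X\<close> is Lipschitz,
    so that uniqueness applies; the bound \<open>norm (\<gamma> t)\<close> excludes the point
    \<open>\<gamma> t\<close> from the open ball containing the turn.\<close>
  define \<epsilon> where "\<epsilon> = min R (norm (\<gamma> t))"
  have "\<epsilon> > 0" using nz[OF \<open>0 \<le> t\<close>] \<open>0 < R\<close> by (simp add: \<epsilon>_def)
  obtain \<delta> where "\<delta> > 0" and \<delta>: "\<forall>p. p \<in> ball 0 \<delta> - {0} \<longrightarrow>
     (\<exists>\<sigma> \<phi> T. 0 < T \<and> solves_on X (U \<inter> ball 0 \<epsilon>) \<sigma> {0..T} \<and> \<sigma> 0 = p \<and>
        polar_angle_on 0 \<sigma> \<phi> {0..T} \<and> \<bar>\<phi> T - \<phi> 0\<bar> = 2 * pi \<and> (\<forall>t\<in>{0..<T}. \<bar>\<phi> t - \<phi> 0\<bar> < 2 * pi))"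
    using mono[unfolded monodromic_def, rule_format, OF \<open>\<epsilon> > 0\<close>] by (elim exE conjE) (rule that)
  have "\<forall>\<^sub>F s in at_top. dist (\<gamma> s) 0 < \<delta>" using lim \<open>\<delta> > 0\<close> by (rule tendstoD)
  then have "\<forall>\<^sub>F s in at_top. dist (\<gamma> s) 0 < \<delta> \<and> t \<le> s" using eventually_ge_at_top by (rule eventually_conj)
  then obtain r where r: "dist (\<gamma> r) 0 < \<delta>" "t \<le> r" by (auto simp: eventually_at_top_linorder)
  have "\<gamma> r \<in> ball 0 \<delta> - {0}" using r nz[of r] \<open>0 \<le> t\<close> by (auto simp: dist_commute)
  obtain \<sigma> \<phi> T where T: "0 < T" and \<sigma>: "solves_on X (U \<inter> ball 0 \<epsilon>) \<sigma> {0..T}" "\<sigma> 0 = \<gamma> r"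
    and \<phi>: "polar_angle_on 0 \<sigma> \<phi> {0..T}" "\<bar>\<phi> T - \<phi> 0\<bar> = 2 * pi"
    using \<delta>[rule_format, OF \<open>\<gamma> r \<in> ball 0 \<delta> - {0}\<close>] by (elim exE conjE) (rule that)
  \<comment> \<open>The end time \<open>T'\<close> is left open because the identification is needed
    twice: for \<open>c = -1\<close> only up to \<open>r - t\<close>, as long as the argument of
    \<open>\<gamma>\<close> is known to stay at or above \<open>t\<close>, and then, after
    \<open>sm\<close>, up to \<open>T\<close>.\<close>
  have eq: "\<gamma> (r + c * s) = \<sigma> s" if T': "T' \<le> T" "t \<le> r + c * T'" and s: "s \<in> {0..T'}" for s T'
  proof (rule solutions_eq_on[where \<gamma> = "\<lambda>s. \<gamma> (r + c * s)" and T = T' and Y = X and L = L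
        and B = "cball 0 R"])
    fix s assume s: "s \<in> {0..T'}"
    have nn: "0 \<le> r + c * s" if "s \<in> {0..T'}" for s
      using c that T' \<open>0 \<le> t\<close> r by auto
    have "((\<lambda>s. \<gamma> (r + c * s)) has_vector_derivative c *\<^sub>R c *\<^sub>R X (\<gamma> (r + c * s))) (at s within {0..T'})"
      using nn s by (intro has_vector_derivative_affine_time conjunct2[OF \<gamma>]) auto
    moreover have "c *\<^sub>R c *\<^sub>R X (\<gamma> (r + c * s)) = X (\<gamma> (r + c * s))" using c by auto
    ultimately show "\<gamma> (r + c * s) \<in> cball 0 R \<and>
        ((\<lambda>s. \<gamma> (r + c * s)) has_vector_derivative X (\<gamma> (r + c * s))) (at s within {0..T'})"
      using \<gamma>[OF nn[OF s]] by simp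
    have "s \<in> {0..T}" using s T' by auto
    then have "\<sigma> s \<in> ball 0 \<epsilon>" "(\<sigma> has_vector_derivative X (\<sigma> s)) (at s within {0..T})"
      using \<sigma>(1) by (auto simp: solves_on_def)
    moreover from this(2) have "(\<sigma> has_vector_derivative X (\<sigma> s)) (at s within {0..T'})"
      by (rule has_vector_derivative_within_subset) (use T' in auto)
    ultimately show "\<sigma> s \<in> cball 0 R \<and> (\<sigma> has_vector_derivative X (\<sigma> s)) (at s within {0..T'})"
      by (simp add: \<epsilon>_def)
  qed (fact lip, use \<sigma>(2) s in auto)
  have sm: "t \<le> r + c * T"
  proof (rule ccontr)
    assume "\<not> ?thesis"
    then have c1: "c = -1" and "r - t < T" using c r T by auto
    then have "\<gamma> (r + c * (r - t)) = \<sigma> (r - t)" using r by (intro eq[of "r - t"]) auto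
    then have "\<sigma> (r - t) = \<gamma> t" using c1 by simp
    moreover have "\<sigma> (r - t) \<in> ball 0 \<epsilon>"
      using \<sigma>(1) \<open>r - t < T\<close> r by (simp add: solves_on_def)
    ultimately show False by (simp add: \<epsilon>_def)
  qed
  have nn: "0 \<le> r + c * s" if "s \<in> {0..T}" for s
    using c that sm \<open>0 \<le> t\<close> r by auto
  have "polar_angle_on 0 \<sigma> (\<lambda>s. \<theta> (r + c * s)) {0..T}"
    unfolding polar_angle_on_def
  proof (intro conjI ballI)
    have "continuous_on {0..} \<theta>" using pol by (simp add: polar_angle_on_def)
    then show "continuous_on {0..T} (\<lambda>s. \<theta> (r + c * s))"
      by (rule continuous_on_compose2) (use nn in \<open>auto intro!: continuous_intros\<close>)
    fix s assume s: "s \<in> {0..T}"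
    have "\<gamma> (r + c * s) = \<sigma> s" using eq[of T s] sm s by simp
    then show "\<sigma> s \<noteq> 0" "\<sigma> s = 0 + norm (\<sigma> s - 0) *\<^sub>R (cos (\<theta> (r + c * s)), sin (\<theta> (r + c * s)))"
      using pol nn[OF s] unfolding polar_angle_on_def by (metis atLeast_iff, metis atLeast_iff)
  qed
  from polar_angle_diff_eq[OF this \<phi>(1)] T \<phi>(2)
  have *: "\<bar>\<theta> (r + c * T) - \<theta> r\<bar> = 2 * pi" by simp
  show ?thesis
  proof (cases "c = 1")
    case True
    then show ?thesis using * r T by (intro exI[of _ r] conjI exI[of _ "r + c * T"]) auto
  next
    case False
    then show ?thesis using * r T sm c
      by (intro exI[of _ "r + c * T"] conjI exI[of _ r]) (auto simp: abs_minus_commute)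
  qed
qed

text \<open>The factor \<open>c\<close> treats convergence in forward and backward time at once: the
  curve follows \<open>c *\<^sub>R X\<close>, while monodromy and the crossing condition speak of
  \<open>X\<close> itself.\<close>

lemma spirals_towardsI:
  assumes mono: "monodromic X U 0"
    and lip: "\<And>p q. p \<in> cball 0 R \<Longrightarrow> q \<in> cball 0 R \<Longrightarrow> norm (X p - X q) \<le> L * norm (p - q)"
    and "0 < R" "cball 0 R \<subseteq> U" "X 0 = 0" and c: "c = 1 \<or> c = (-1::real)"
    and cross: "\<And>y. 0 < y \<Longrightarrow> y \<le> R \<Longrightarrow> 0 < fst (X (0, y))"
    and \<gamma>: "\<And>t. 0 \<le> t \<Longrightarrow> \<gamma> t \<in> cball 0 R \<and> (\<gamma> has_vector_derivative c *\<^sub>R X (\<gamma> t)) (at t within {0..})"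
    and lim: "(\<gamma> \<longlongrightarrow> 0) at_top" and "\<gamma> 0 = p" "p \<noteq> 0"
  shows "spirals_towards (\<lambda>q. c *\<^sub>R X q) U 0 p"
proof -
  have lipc: "norm (c *\<^sub>R X p - c *\<^sub>R X q) \<le> L * norm (p - q)"
    if "p \<in> cball 0 R" "q \<in> cball 0 R" for p q
    using lip[OF that] c by (auto simp: norm_minus_commute)
  have nz: "\<gamma> t \<noteq> 0" if "0 \<le> t" for t
  proof (rule solution_nonzero[where Y = "\<lambda>q. c *\<^sub>R X q" and R = R and L = L and t = t])
    show "norm (c *\<^sub>R X p - c *\<^sub>R X q) \<le> L * norm (p - q)"
      if "p \<in> cball 0 R" "q \<in> cball 0 R" for p q by (rule lipc[OF that])
    show "\<gamma> t \<in> cball 0 R \<and> (\<gamma> has_vector_derivative c *\<^sub>R X (\<gamma> t)) (at t within {0..})"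
      if "0 \<le> t" for t by (rule \<gamma>[OF that])
  qed (use assms that in \<open>simp_all add: less_imp_le\<close>)
  have cont: "continuous_on {0..} \<gamma>"
    using \<gamma> by (intro has_vector_derivative_imp_continuous_on) blast
  then obtain \<theta> where \<theta>: "polar_angle_on 0 \<gamma> \<theta> {0..}"
    using polar_angle_exists[OF cont] nz by auto
  have polar: "\<gamma> t = norm (\<gamma> t) *\<^sub>R (cos (\<theta> t), sin (\<theta> t))" if "0 \<le> t" for t
    using \<theta> that by (simp add: polar_angle_on_def)
  \<comment> \<open>\<open>g\<close> measures the angle from the positive \<open>y\<close>-axis,
    with orientation reversed for \<open>c = -1\<close>. The signed distance becomes
    \<open>- c * fst (\<gamma> t)\<close>, whose derivative on that axis is
    \<open>- fst (X (\<gamma> t)) < 0\<close> for both signs, because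
    \<open>c * c = 1\<close>.\<close>
  define g where "g t = c * (\<theta> t - pi / 2)" for t
  have \<theta>g: "\<theta> t = pi / 2 + c * g t" for t using c by (auto simp: g_def)
  have "filterlim g at_bot at_top"
  proof (rule angle_at_bot[where h = "\<lambda>t. - c * fst (\<gamma> t)" and \<rho> = "\<lambda>t. norm (\<gamma> t)"])
    have "continuous_on {0..} \<theta>" using \<theta> by (simp add: polar_angle_on_def)
    then show "continuous_on {0..} g" unfolding g_def by (intro continuous_intros)
    show "- c * fst (\<gamma> t) = norm (\<gamma> t) * sin (g t) \<and> 0 < norm (\<gamma> t)" if "0 \<le> t" for t
    proof -
      have "fst (\<gamma> t) = norm (\<gamma> t) * cos (\<theta> t)" using arg_cong[OF polar[OF that], of fst] by simp
      then show ?thesis using c nz[OF that] by (auto simp: \<theta>g cos_add)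
    qed
    show "\<exists>d<0. ((\<lambda>t. - c * fst (\<gamma> t)) has_real_derivative d) (at t within {0..})"
      if t: "0 \<le> t" and "sin (g t) = 0" "cos (g t) = 1" for t
    proof -
      have "cos (\<theta> t) = 0" "sin (\<theta> t) = 1"
        using c that by (auto simp: \<theta>g cos_add sin_add)
      then have \<gamma>t: "\<gamma> t = (0, norm (\<gamma> t))" using polar[OF t] by simp
      have "0 < fst (X (0, norm (\<gamma> t)))" using \<gamma>[OF t] nz[OF t] by (intro cross) auto
      then have "0 < fst (X (\<gamma> t))" using \<gamma>t by simp
      have "(\<gamma> has_derivative (\<lambda>h. h *\<^sub>R (c *\<^sub>R X (\<gamma> t)))) (at t within {0..})"
        using \<gamma>[OF t] by (simp add: has_vector_derivative_def)
      then have "((\<lambda>t. - c * fst (\<gamma> t)) has_derivative (\<lambda>h. - c * fst (h *\<^sub>R (c *\<^sub>R X (\<gamma> t))))) (at t within {0..})"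
        by (intro has_derivative_mult_right has_derivative_fst)
      moreover have "(\<lambda>h. - c * fst (h *\<^sub>R (c *\<^sub>R X (\<gamma> t)))) = (*) (- fst (X (\<gamma> t)))"
        using c by (auto simp: fun_eq_iff)
      ultimately have "((\<lambda>t. - c * fst (\<gamma> t)) has_real_derivative - fst (X (\<gamma> t))) (at t within {0..})"
        by (simp add: has_field_derivative_def)
      with \<open>0 < fst (X (\<gamma> t))\<close> show ?thesis by (intro exI[of _ "- fst (X (\<gamma> t))"]) simp
    qed
    show "\<exists>r\<ge>t. \<exists>s\<ge>r. \<bar>g s - g r\<bar> = 2 * pi" if t: "0 \<le> t" for t
    proof -
      have "\<exists>r\<ge>t. \<exists>s\<ge>r. \<bar>\<theta> s - \<theta> r\<bar> = 2 * pi"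
        by (rule monodromic_turn[OF mono _ \<open>0 < R\<close> c _ lim \<theta> t]) (fact lip, fact \<gamma>)
      moreover have "\<bar>g s - g r\<bar> = \<bar>\<theta> s - \<theta> r\<bar>" for r s using c by (auto simp: g_def)
      ultimately show ?thesis by simp
    qed
  qed
  then have "filterlim (\<lambda>t. - (pi / 2) + - g t) at_top at_top"
    by (intro filterlim_tendsto_add_at_top[OF tendsto_const]) (simp add: filterlim_uminus_at_top)
  then have "filterlim (\<lambda>t. \<bar>\<theta> t\<bar>) at_top at_top"
  proof (rule filterlim_at_top_mono[OF _ always_eventually[OF allI]])
    fix t
    have "\<theta> t = pi / 2 + g t \<or> \<theta> t = pi / 2 - g t" using c by (auto simp: \<theta>g)
    then show "- (pi / 2) + - g t \<le> \<bar>\<theta> t\<bar>" using pi_gt_zero by linarith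
  qed
  moreover have "solves_on (\<lambda>q. c *\<^sub>R X q) U \<gamma> {0..}"
    using \<gamma> \<open>cball 0 R \<subseteq> U\<close> unfolding solves_on_def by (meson atLeast_iff subsetD)
  ultimately show ?thesis
    using \<open>\<gamma> 0 = p\<close> lim \<theta> unfolding spirals_towards_def by (intro exI[of _ \<gamma>] exI[of _ \<theta>]) simp
qed

section \<open>Lyapunov's direct method\<close>

text \<open>The rate \<open>c = 0\<close> serves for stability, a positive lower bound of
  \<open>W\<close> for attraction.\<close>

lemma lyapunov_decrease:
  fixes V :: "'a::real_normed_vector \<Rightarrow> real" and \<gamma> :: "real \<Rightarrow> 'a"
  assumes \<gamma>: "\<And>s. s \<in> {r..t} \<Longrightarrow> (\<gamma> has_vector_derivative Y (\<gamma> s)) (at s within {r..t})"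
    and V: "\<And>s. s \<in> {r..t} \<Longrightarrow> (V has_derivative V' (\<gamma> s)) (at (\<gamma> s))"
    and le: "\<And>s. s \<in> {r..t} \<Longrightarrow> V' (\<gamma> s) (Y (\<gamma> s)) \<le> - c"
    and "r \<le> t"
  shows "V (\<gamma> t) \<le> V (\<gamma> r) - c * (t - r)"
proof -
  have d: "((\<lambda>s. V (\<gamma> s) + c * s) has_real_derivative V' (\<gamma> s) (Y (\<gamma> s)) + c) (at s within {r..t})"
    if s: "s \<in> {r..t}" for s
  proof -
    have "(V has_derivative V' (\<gamma> s)) (at (\<gamma> s) within \<gamma> ` {r..t})"
      using V[OF s] by (rule has_derivative_at_withinI)
    from vector_derivative_diff_chain_within[OF \<gamma>[OF s] this]
    have "((\<lambda>s. V (\<gamma> s)) has_real_derivative V' (\<gamma> s) (Y (\<gamma> s))) (at s within {r..t})"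
      by (simp add: o_def has_real_derivative_iff_has_vector_derivative)
    then show ?thesis by (auto intro!: derivative_eq_intros)
  qed
  have "V (\<gamma> t) + c * t \<le> V (\<gamma> r) + c * r"
  proof (rule DERIV_nonpos_imp_decreasing_open[where f = "\<lambda>s. V (\<gamma> s) + c * s", OF \<open>r \<le> t\<close>])
    show "continuous_on {r..t} (\<lambda>s. V (\<gamma> s) + c * s)"
      using d by (intro has_vector_derivative_imp_continuous_on)
        (auto simp: has_real_derivative_iff_has_vector_derivative)
    fix s assume "r < s" "s < t"
    then have s: "s \<in> {r..t}" "s \<in> interior {r..t}" by auto
    with d[OF s(1)] have "((\<lambda>s. V (\<gamma> s) + c * s) has_real_derivative V' (\<gamma> s) (Y (\<gamma> s)) + c) (at s)"
      by (metis at_within_interior)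
    with le[OF s(1)] show "\<exists>y. ((\<lambda>s. V (\<gamma> s) + c * s) has_real_derivative y) (at s) \<and> y \<le> 0" 
      by (intro exI conjI) auto
  qed
  then show ?thesis by (simp add: algebra_simps)
qed

text \<open>The minimum of \<open>V\<close> on the sphere of radius \<open>\<epsilon>\<close> is a
  level that a curve starting lower cannot reach. The curve has to follow \<open>Y\<close> only
  while it is in the ball, because the lemma is first applied to solutions of a truncated equation
  that are not yet known to stay there. The free starting time \<open>r\<close> serves convergence,
  where the small ball is entered late.\<close>

lemma lyapunov_stable:
  fixes Y :: "'a::euclidean_space \<Rightarrow> 'a" and V :: "'a \<Rightarrow> real"
  assumes V: "\<And>p. p \<in> cball 0 R \<Longrightarrow> (V has_derivative V' p) (at p)"
    and V0: "V 0 = 0" and pos: "\<And>p. p \<in> cball 0 R \<Longrightarrow> p \<noteq> 0 \<Longrightarrow> 0 < V p"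
    and le: "\<And>p. p \<in> cball 0 R \<Longrightarrow> V' p (Y p) \<le> 0"
    and \<epsilon>: "0 < \<epsilon>" "\<epsilon> \<le> R"
  shows "\<exists>\<delta>>0. \<forall>\<gamma> r t. continuous_on {0..} \<gamma> \<longrightarrow>
      (\<forall>s\<ge>0. \<gamma> s \<in> cball 0 R \<longrightarrow> (\<gamma> has_vector_derivative Y (\<gamma> s)) (at s within {0..})) \<longrightarrow>
      0 \<le> r \<longrightarrow> r \<le> t \<longrightarrow> \<gamma> r \<in> ball 0 \<delta> \<longrightarrow> \<gamma> t \<in> ball 0 \<epsilon>"
proof -
  have contV: "continuous_on (cball 0 R) V"
    using V by (meson continuous_at_imp_continuous_on has_derivative_continuous)
  have "continuous_on (sphere 0 \<epsilon>) V"
    by (rule continuous_on_subset[OF contV]) (use \<epsilon> in auto)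
  moreover have "sphere (0::'a) \<epsilon> \<noteq> {}" using \<epsilon> by simp
  ultimately obtain q where q: "q \<in> sphere 0 \<epsilon>" "\<And>p. p \<in> sphere 0 \<epsilon> \<Longrightarrow> V q \<le> V p"
    using continuous_attains_inf[OF compact_sphere] by blast
  have "0 < V q" using q \<epsilon> by (intro pos) auto
  moreover have "isCont V 0" using V[of 0] \<epsilon> by (auto intro: has_derivative_continuous)
  ultimately have "\<exists>d>0. \<forall>p. dist p 0 < d \<longrightarrow> dist (V p) (V 0) < V q"
    unfolding continuous_at_eps_delta by blast
  then obtain d where d: "0 < d" "\<And>p. dist p 0 < d \<Longrightarrow> dist (V p) (V 0) < V q" by blast
  show ?thesis
  proof (intro exI[of _ "min d \<epsilon>"] conjI allI impI)
    show "0 < min d \<epsilon>" using d \<epsilon> by simp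
    fix \<gamma> :: "real \<Rightarrow> 'a" and r t :: real
    assume cont: "continuous_on {0..} \<gamma>" and "0 \<le> r" "r \<le> t" and r: "\<gamma> r \<in> ball 0 (min d \<epsilon>)"
      and \<gamma>: "\<forall>s\<ge>0. \<gamma> s \<in> cball 0 R \<longrightarrow> (\<gamma> has_vector_derivative Y (\<gamma> s)) (at s within {0..})"
    show "\<gamma> t \<in> ball 0 \<epsilon>"
    proof (rule ccontr)
      assume "\<gamma> t \<notin> ball 0 \<epsilon>"
      \<comment> \<open>The infimum \<open>u\<close> of \<open>S\<close> is the first time at which
        the sphere is reached; up to then the curve stays in the ball where \<open>V\<close>
        decreases.\<close>
      define S where "S = {r..t} \<inter> (\<lambda>s. norm (\<gamma> s)) -` {\<epsilon>..}"
      have contn: "continuous_on {r..t} (\<lambda>s. norm (\<gamma> s))"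
        by (intro continuous_intros continuous_on_subset[OF cont]) (use \<open>0 \<le> r\<close> in auto)
      then have "closed S" unfolding S_def by (rule continuous_closed_preimage) auto
      moreover have "S \<noteq> {}" "bdd_below S"
        using \<open>\<gamma> t \<notin> ball 0 \<epsilon>\<close> \<open>r \<le> t\<close> by (auto simp: S_def)
      ultimately have "Inf S \<in> S" by (rule closed_contains_Inf[rotated 2])
      define u where "u = Inf S"
      have u: "r \<le> u" "u \<le> t" "\<epsilon> \<le> norm (\<gamma> u)" using \<open>Inf S \<in> S\<close> by (auto simp: S_def u_def)
      have below: "norm (\<gamma> s) < \<epsilon>" if "r \<le> s" "s < u" for s
      proof (rule ccontr)
        assume "\<not> ?thesis"
        then have "s \<in> S" using that u by (auto simp: S_def)
        then have "u \<le> s" unfolding u_def using \<open>bdd_below S\<close> by (rule cInf_lower)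
        with that show False by simp
      qed
      have "\<exists>s. r \<le> s \<and> s \<le> u \<and> norm (\<gamma> s) = \<epsilon>"
        using u r by (intro IVT' continuous_on_subset[OF contn]) auto
      then obtain s where "r \<le> s" "s \<le> u" "norm (\<gamma> s) = \<epsilon>" by blast
      then have "norm (\<gamma> u) = \<epsilon>" using below[of s] by (cases "s = u") auto
      have in_cball: "\<gamma> s \<in> cball 0 R" if "s \<in> {r..u}" for s
        using below[of s] \<open>norm (\<gamma> u) = \<epsilon>\<close> \<epsilon> that by (cases "s = u") auto
      have "V (\<gamma> u) \<le> V (\<gamma> r) - 0 * (u - r)"
      proof (rule lyapunov_decrease[where V' = V' and Y = Y])
        fix s assume s: "s \<in> {r..u}"
        have "(\<gamma> has_vector_derivative Y (\<gamma> s)) (at s within {0..})"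
          using \<gamma> s \<open>0 \<le> r\<close> in_cball[OF s] by simp
        then show "(\<gamma> has_vector_derivative Y (\<gamma> s)) (at s within {r..u})"
          by (rule has_vector_derivative_within_subset) (use \<open>0 \<le> r\<close> in auto)
        show "(V has_derivative V' (\<gamma> s)) (at (\<gamma> s))" "V' (\<gamma> s) (Y (\<gamma> s)) \<le> - 0"
          using V le in_cball[OF s] by auto
      qed (use u in auto)
      also have "V (\<gamma> r) < V q" using d(2)[of "\<gamma> r"] r by (auto simp: V0 dist_real_def)
      also have "V q \<le> V (\<gamma> u)" using q(2)[of "\<gamma> u"] \<open>norm (\<gamma> u) = \<epsilon>\<close> by simp
      finally show False by simp
    qed
  qed
qed

text \<open>Global existence comes from truncation: composing \<open>Y\<close> with the projection
  onto the ball gives a globally Lipschitz field. Stability then shows that its solutions never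
  leave the ball, so that they solve the original equation.\<close>

lemma lyapunov_asymptotically_stable:
  fixes Y :: "'a::euclidean_space \<Rightarrow> 'a" and V W :: "'a \<Rightarrow> real"
  assumes "0 < R" "0 < L"
    and lip: "\<And>p q. p \<in> cball 0 R \<Longrightarrow> q \<in> cball 0 R \<Longrightarrow> norm (Y p - Y q) \<le> L * norm (p - q)"
    and Y0: "Y 0 = 0"
    and V: "\<And>p. p \<in> cball 0 R \<Longrightarrow> (V has_derivative V' p) (at p)"
    and V0: "V 0 = 0" and posV: "\<And>p. p \<in> cball 0 R \<Longrightarrow> p \<noteq> 0 \<Longrightarrow> 0 < V p"
    and contW: "continuous_on (cball 0 R) W" and posW: "\<And>p. p \<in> cball 0 R \<Longrightarrow> p \<noteq> 0 \<Longrightarrow> 0 < W p"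
    and le: "\<And>p. p \<in> cball 0 R \<Longrightarrow> p \<noteq> 0 \<Longrightarrow> V' p (Y p) \<le> - W p"
  shows "\<exists>\<delta>>0. \<forall>p\<in>ball 0 \<delta>. \<exists>\<gamma>. \<gamma> 0 = p \<and> (\<gamma> \<longlongrightarrow> 0) at_top \<and>
      (\<forall>t\<ge>0. \<gamma> t \<in> cball 0 R \<and> (\<gamma> has_vector_derivative Y (\<gamma> t)) (at t within {0..}))"
proof -
  \<comment> \<open>The decay hypothesis omits the origin; there \<open>Y\<close> vanishes and a
    derivative maps 0 to 0.\<close>
  have "V' 0 0 = 0"
    using has_derivative_bounded_linear[OF V[of 0]] \<open>0 < R\<close> by (simp add: linear_simps(3))
  then have le0: "V' p (Y p) \<le> 0" if "p \<in> cball 0 R" for p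
    using le[OF that] posW[OF that] Y0 by (cases "p = 0") auto
  have stable: "\<exists>\<delta>>0. \<forall>\<gamma> r t. continuous_on {0..} \<gamma> \<longrightarrow>
      (\<forall>s\<ge>0. \<gamma> s \<in> cball 0 R \<longrightarrow> (\<gamma> has_vector_derivative Y (\<gamma> s)) (at s within {0..})) \<longrightarrow>
      0 \<le> r \<longrightarrow> r \<le> t \<longrightarrow> \<gamma> r \<in> ball 0 \<delta> \<longrightarrow> \<gamma> t \<in> ball 0 \<epsilon>" if "0 < \<epsilon>" "\<epsilon> \<le> R" for \<epsilon>
    by (rule lyapunov_stable[of R V V' Y])
       (fact V, fact V0, fact posV, fact le0, fact that(1), fact that(2))
  obtain \<delta> where "0 < \<delta>" and \<delta>:
    "\<forall>\<gamma> r t. continuous_on {0..} \<gamma> \<longrightarrow>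
      (\<forall>s\<ge>0. \<gamma> s \<in> cball 0 R \<longrightarrow> (\<gamma> has_vector_derivative Y (\<gamma> s)) (at s within {0..})) \<longrightarrow>
      0 \<le> r \<longrightarrow> r \<le> t \<longrightarrow> \<gamma> r \<in> ball 0 \<delta> \<longrightarrow> \<gamma> t \<in> ball 0 R"
    using stable[OF \<open>0 < R\<close> order_refl] by (elim exE conjE) (rule that)
  let ?c = "closest_point (cball (0::'a) R)"
  have cin: "?c p \<in> cball 0 R" for p using \<open>0 < R\<close> by (intro closest_point_in_set) auto
  have lipc: "norm (Y (?c p) - Y (?c q)) \<le> L * norm (p - q)" for p q
  proof -
    have "norm (?c p - ?c q) \<le> norm (p - q)"
      using closest_point_lipschitz[of "cball (0::'a) R" p q] \<open>0 < R\<close> by (simp add: dist_norm)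
    then have "L * norm (?c p - ?c q) \<le> L * norm (p - q)" using \<open>0 < L\<close> by simp
    with lip[OF cin cin, of p q] show ?thesis by linarith
  qed
  show ?thesis
  proof (intro exI[of _ \<delta>] conjI ballI)
    show "0 < \<delta>" by fact
    fix p :: 'a assume p: "p \<in> ball 0 \<delta>"
    obtain \<gamma> where \<gamma>0: "\<gamma> 0 = p"
      and \<gamma>c: "\<And>t. 0 \<le> t \<Longrightarrow> (\<gamma> has_vector_derivative Y (?c (\<gamma> t))) (at t within {0..})"
      using lipschitz_ode_global_solution[of "\<lambda>p. Y (?c p)" L p] lipc \<open>0 < L\<close> by blast
    have cont: "continuous_on {0..} \<gamma>"
      using \<gamma>c by (intro has_vector_derivative_imp_continuous_on) auto
    have \<gamma>Y: "(\<gamma> has_vector_derivative Y (\<gamma> s)) (at s within {0..})"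
      if "0 \<le> s" "\<gamma> s \<in> cball 0 R" for s
      using \<gamma>c[OF that(1)] closest_point_self[OF that(2)] by simp
    have inR: "\<gamma> t \<in> cball 0 R" if "0 \<le> t" for t
    proof -
      have "\<gamma> t \<in> ball 0 R"
        using \<delta>[rule_format, OF cont \<gamma>Y, of 0 t] that p \<gamma>0 by simp
      then show ?thesis by simp
    qed
    have "(\<gamma> \<longlongrightarrow> 0) at_top"
    proof (rule tendstoI)
      fix e :: real assume "0 < e"
      define \<epsilon> where "\<epsilon> = min e R"
      have \<epsilon>: "0 < \<epsilon>" "\<epsilon> \<le> R" using \<open>0 < e\<close> \<open>0 < R\<close> by (auto simp: \<epsilon>_def)
      obtain d where "0 < d" and d:
        "\<forall>\<gamma> r t. continuous_on {0..} \<gamma> \<longrightarrow>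
          (\<forall>s\<ge>0. \<gamma> s \<in> cball 0 R \<longrightarrow> (\<gamma> has_vector_derivative Y (\<gamma> s)) (at s within {0..})) \<longrightarrow>
          0 \<le> r \<longrightarrow> r \<le> t \<longrightarrow> \<gamma> r \<in> ball 0 d \<longrightarrow> \<gamma> t \<in> ball 0 \<epsilon>"
        using stable[OF \<epsilon>] by (elim exE conjE) (rule that)
      have "\<exists>r\<ge>0. \<gamma> r \<in> ball 0 d"
      \<comment> \<open>An orbit that never came close to 0 would stay in a compact annulus where
        \<open>W\<close> has a positive minimum, so \<open>V\<close> would fall at least linearly
        and become negative.\<close>
      proof (rule ccontr)
        assume no: "\<not> ?thesis"
        let ?A = "cball 0 R - ball (0::'a) d"
        have inA: "\<gamma> t \<in> ?A" if "0 \<le> t" for t using no inR that by auto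
        have "continuous_on ?A W" by (rule continuous_on_subset[OF contW]) auto
        moreover have "compact ?A" "?A \<noteq> {}" using inA[of 0] by (auto simp: compact_diff)
        ultimately obtain q where q: "q \<in> ?A" "\<And>p. p \<in> ?A \<Longrightarrow> W q \<le> W p"
          using continuous_attains_inf[of ?A W] by blast
        have "0 < W q" using q(1) \<open>0 < d\<close> by (intro posW) auto
        \<comment> \<open>At this time the linear bound \<open>V p - W q * t\<close> equals
          \<open>- W q\<close>, which is below 0.\<close>
        define t where "t = V p / W q + 1"
        have "0 \<le> V p" using posV[of p] V0 inR[of 0] \<gamma>0 by (cases "p = 0") auto
        then have "0 \<le> t" using \<open>0 < W q\<close> by (simp add: t_def)
        have "V (\<gamma> t) \<le> V (\<gamma> 0) - W q * (t - 0)"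
        proof (rule lyapunov_decrease[where V' = V' and Y = Y])
          fix s assume s: "s \<in> {0..t}"
          then have s0: "0 \<le> s" by simp
          show "(\<gamma> has_vector_derivative Y (\<gamma> s)) (at s within {0..t})"
            by (rule has_vector_derivative_within_subset[OF \<gamma>Y[OF s0 inR[OF s0]]]) auto
          show "(V has_derivative V' (\<gamma> s)) (at (\<gamma> s))" by (rule V[OF inR[OF s0]])
          have "\<gamma> s \<noteq> 0" using inA[OF s0] \<open>0 < d\<close> by auto
          then show "V' (\<gamma> s) (Y (\<gamma> s)) \<le> - W q"
            using le[OF inR[OF s0]] q(2)[OF inA[OF s0]] by linarith
        qed (rule \<open>0 \<le> t\<close>)
        also have "W q * (t - 0) = V p + W q"
          using \<open>0 < W q\<close> by (simp add: t_def distrib_left)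
        finally have "V (\<gamma> t) < 0" using \<gamma>0 \<open>0 < W q\<close> by simp
        moreover have "\<gamma> t \<noteq> 0" using inA[OF \<open>0 \<le> t\<close>] \<open>0 < d\<close> by auto
        ultimately show False using posV[OF inR[OF \<open>0 \<le> t\<close>]] by simp
      qed
      then obtain r where r: "0 \<le> r" "\<gamma> r \<in> ball 0 d" by blast
      have "dist (\<gamma> t) 0 < e" if "r \<le> t" for t
        using d[rule_format, OF cont \<gamma>Y r(1) that r(2)] by (simp add: \<epsilon>_def dist_commute)
      then show "\<forall>\<^sub>F t in at_top. dist (\<gamma> t) 0 < e"
        by (auto simp: eventually_at_top_linorder)
    qed
    then show "\<exists>\<gamma>. \<gamma> 0 = p \<and> (\<gamma> \<longlongrightarrow> 0) at_top \<and>
      (\<forall>t\<ge>0. \<gamma> t \<in> cball 0 R \<and> (\<gamma> has_vector_derivative Y (\<gamma> t)) (at t within {0..}))"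
      using \<gamma>0 inR \<gamma>Y by (intro exI[of _ \<gamma>]) simp
  qed
qed

section \<open>A Lyapunov function for the nilpotent system\<close>

text \<open>
  Here \<open>c\<close> stands for \<open>x\<^sup>n\<^sup>-\<^sup>1\<close>, and \<open>E\<close> for the remainder in \<open>u' = a x c\<^sup>2 + b c u + E\<close>.  The two conclusions
  say that \<open>V' \<ge> \<kappa> (x\<^sup>2 c\<^sup>3 + c u\<^sup>2 + \<bar>u\<bar>\<^sup>3)\<close> (up to the factor \<open>sgn b\<close>) and \<open>V > 0\<close>.
\<close>
lemma lyapunov_derivative_estimate:
  fixes a b C :: real and n :: nat
  assumes "a < 0" "b \<noteq> 0" "0 \<le> C" "0 < n"
  obtains \<epsilon> K \<eta> \<kappa> m :: real where "0 < \<eta>" "0 < \<kappa>" "0 < m"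
    "\<forall>x u c E. \<bar>x\<bar> \<le> m \<longrightarrow> 0 \<le> c \<longrightarrow> \<bar>E\<bar> \<le> \<eta> * (\<bar>x\<bar> * c\<^sup>2 + c * \<bar>u\<bar>) + C * u\<^sup>2 \<longrightarrow>
       \<kappa> * (x\<^sup>2 * c ^ 3 + c * u\<^sup>2 + \<bar>u\<bar> ^ 3) \<le>
       sgn b * (u * (a * x * c\<^sup>2 + b * c * u + E) - a * x * c\<^sup>2 * u)
       - \<epsilon> * (real n * c * u\<^sup>2 + x * c * (a * x * c\<^sup>2 + b * c * u + E))
       + K * (u\<^sup>2 * \<bar>u\<bar> + 2 * x * \<bar>u\<bar> * (a * x * c\<^sup>2 + b * c * u + E))"
    "\<forall>x u c. \<bar>x\<bar> \<le> m \<longrightarrow> u \<noteq> 0 \<or> x * c \<noteq> 0 \<longrightarrow>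
       0 < u\<^sup>2 / 2 - a * (x * c)\<^sup>2 / (2 * real n) + sgn b * (K * x * (u * \<bar>u\<bar>) - \<epsilon> * (x * c) * u)"
proof -
  define N where "N = real n"
  have N: "N > 0" using \<open>0 < n\<close> by (simp add: N_def)
  \<comment> \<open>The first two bounds keep \<open>\<epsilon> x c u\<close> below half of the
    energy, for the positivity of \<open>V\<close>. The third makes the loss
    \<open>\<epsilon> (N + b^2 / |a|) c u^2\<close> at most a quarter of
    \<open>|b| c u^2\<close>.\<close>
  define \<epsilon> where "\<epsilon> = min (1/4) (min (\<bar>a\<bar> / (2 * N)) (\<bar>b\<bar> / (4 * (N + b\<^sup>2 / \<bar>a\<bar>))))"
  define K where "K = C + 1"
  \<comment> \<open>The gains left for \<open>x^2 c^3\<close> and \<open>c u^2\<close> are three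
    quarters of \<open>\<epsilon> |a|\<close> and of \<open>|b|\<close>, both at least
    \<open>3 \<kappa>\<close>, so that errors up to \<open>2 \<kappa>\<close> are affordable. For
    \<open>|u|^3\<close> the gain is \<open>K - C = 1\<close> and the error at most
    \<open>\<kappa>\<close>, whence the bound \<open>1/2\<close>.\<close>
  define \<kappa> where "\<kappa> = min (\<epsilon> * \<bar>a\<bar> / 4) (min (\<bar>b\<bar> / 4) (1/2))"
  define \<eta> where "\<eta> = min 1 (\<kappa> / 3)"
  \<comment> \<open>\<open>D\<close> collects the coefficients of all errors that carry a factor
    \<open>|x|\<close>; the first bound on \<open>m\<close> makes their sum at most
    \<open>\<kappa>\<close>, the second one is for the positivity of \<open>V\<close>.\<close>
  define D where "D = C + 2 * K * (\<bar>a\<bar> + \<bar>b\<bar> + 2 + C)"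
  define m where "m = min (\<kappa> / D) (1 / (8 * K))"
  have pos: "0 < N + b\<^sup>2 / \<bar>a\<bar>" using N by (rule add_pos_nonneg) simp
  have "0 < \<bar>a\<bar> / (2 * N)" "0 < \<bar>b\<bar> / (4 * (N + b\<^sup>2 / \<bar>a\<bar>))"
    using pos N assms by (intro divide_pos_pos mult_pos_pos; simp)+
  then have \<epsilon>: "0 < \<epsilon>" "\<epsilon> \<le> 1/4" "\<epsilon> \<le> \<bar>a\<bar> / (2 * N)" "\<epsilon> \<le> \<bar>b\<bar> / (4 * (N + b\<^sup>2 / \<bar>a\<bar>))"
    unfolding \<epsilon>_def by linarith+
  have \<epsilon>b: "\<epsilon> * (N + b\<^sup>2 / \<bar>a\<bar>) \<le> \<bar>b\<bar> / 4"
  proof -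
    have "\<epsilon> * (N + b\<^sup>2 / \<bar>a\<bar>) \<le> \<bar>b\<bar> / (4 * (N + b\<^sup>2 / \<bar>a\<bar>)) * (N + b\<^sup>2 / \<bar>a\<bar>)"
      using \<epsilon>(4) less_imp_le[OF pos] by (rule mult_right_mono)
    also have "\<dots> = \<bar>b\<bar> / 4" using pos by (simp only: times_divide_eq_left mult_divide_mult_cancel_right)
    finally show ?thesis .
  qed
  have \<epsilon>a: "\<epsilon> / 2 \<le> \<bar>a\<bar> / (4 * N)" using \<epsilon>(3) by simp
  have K: "0 < K" using \<open>0 \<le> C\<close> by (simp add: K_def)
  have \<kappa>: "0 < \<kappa>" "\<kappa> \<le> \<epsilon> * \<bar>a\<bar> / 4" "\<kappa> \<le> \<bar>b\<bar> / 4" "\<kappa> \<le> 1/2"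
  proof -
    have "0 < \<epsilon> * \<bar>a\<bar>" using \<epsilon>(1) \<open>a < 0\<close> by (intro mult_pos_pos) simp_all
    moreover have "0 < \<bar>b\<bar>" using \<open>b \<noteq> 0\<close> by simp
    ultimately show "0 < \<kappa>" "\<kappa> \<le> \<epsilon> * \<bar>a\<bar> / 4" "\<kappa> \<le> \<bar>b\<bar> / 4" "\<kappa> \<le> 1/2"
      unfolding \<kappa>_def by linarith+
  qed
  have \<eta>: "0 < \<eta>" "\<eta> \<le> 1" "3 * \<eta> \<le> \<kappa>" using \<kappa> by (auto simp: \<eta>_def)
  have "0 < \<bar>a\<bar> + \<bar>b\<bar> + 2 + C" using \<open>0 \<le> C\<close> by linarith
  then have D: "0 < D" using K \<open>0 \<le> C\<close> by (simp add: D_def add_nonneg_pos)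
  have m: "0 < m" using D K \<kappa> by (simp add: m_def)
  have mD: "x * D \<le> \<kappa>" if "x \<le> m" for x
    using that D by (simp add: m_def pos_le_divide_eq)
  have mK: "x * K \<le> 1/8" if "x \<le> m" for x
    using that K by (simp add: m_def pos_le_divide_eq)
  have decay: "\<kappa> * (x\<^sup>2 * c ^ 3 + c * u\<^sup>2 + \<bar>u\<bar> ^ 3) \<le>
       sgn b * (u * (a * x * c\<^sup>2 + b * c * u + E) - a * x * c\<^sup>2 * u)
       - \<epsilon> * (real n * c * u\<^sup>2 + x * c * (a * x * c\<^sup>2 + b * c * u + E))
       + K * (u\<^sup>2 * \<bar>u\<bar> + 2 * x * \<bar>u\<bar> * (a * x * c\<^sup>2 + b * c * u + E))"
    if x: "\<bar>x\<bar> \<le> m" and c: "0 \<le> c" and E: "\<bar>E\<bar> \<le> \<eta> * (\<bar>x\<bar> * c\<^sup>2 + c * \<bar>u\<bar>) + C * u\<^sup>2"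
    for x u c E
  proof -
    define y v where "y = \<bar>x\<bar>" and "v = \<bar>u\<bar>"
    \<comment> \<open>\<open>A\<close>, \<open>B\<close> and \<open>G\<close> are the monomials of
      the desired lower bound. \<open>S\<close> is the mixed monomial of indefinite origin; it has
      to be absorbed by \<open>A\<close> and \<open>B\<close>.\<close>
    define A B S G where "A = x\<^sup>2 * c ^ 3" and "B = c * u\<^sup>2" and "S = y * c\<^sup>2 * v" and "G = v ^ 3"
    have yv: "0 \<le> y" "0 \<le> v" "y\<^sup>2 = x\<^sup>2" "v\<^sup>2 = u\<^sup>2" by (simp_all add: y_def v_def)
    have nn: "0 \<le> A" "0 \<le> B" "0 \<le> S" "0 \<le> G"
      using c yv by (auto simp: A_def B_def S_def G_def)
    have "0 \<le> c * (y * c - v)\<^sup>2" using c by simp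
    also have "\<dots> = A + B - 2 * S"
      unfolding A_def B_def S_def yv(3,4)[symmetric]
      by (simp add: power2_diff algebra_simps power2_eq_square power3_eq_cube)
    finally have S: "S \<le> A + B" using nn by simp
    \<comment> \<open>A weighted form of the preceding square: \<open>|b| S\<close> may cost only a
      quarter of the gain \<open>|a| A\<close>, since both carry the same factor
      \<open>\<epsilon>\<close> and shrinking it does not help. The price on \<open>B\<close> is
      \<open>b^2 / |a|\<close>, which explains the third bound on \<open>\<epsilon>\<close>.\<close>
    have "0 \<le> c * (\<bar>a\<bar> * y * c / 2 - \<bar>b\<bar> * v)\<^sup>2" using c by simp
    also have "\<dots> = \<bar>a\<bar> * (\<bar>a\<bar> / 4 * A + b\<^sup>2 / \<bar>a\<bar> * B - \<bar>b\<bar> * S)"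
      using \<open>a < 0\<close> unfolding A_def B_def S_def yv(3,4)[symmetric]
      by (simp add: power2_diff algebra_simps power2_eq_square power3_eq_cube)
    finally have "0 \<le> \<bar>a\<bar> / 4 * A + b\<^sup>2 / \<bar>a\<bar> * B - \<bar>b\<bar> * S"
      using \<open>a < 0\<close> by (subst (asm) zero_le_mult_iff) linarith
    then have bS: "\<bar>b\<bar> * S \<le> \<bar>a\<bar> / 4 * A + b\<^sup>2 / \<bar>a\<bar> * B" by linarith
    have E': "\<bar>E\<bar> \<le> \<eta> * (y * c\<^sup>2 + c * v) + C * v\<^sup>2" using E by (simp add: y_def v_def)
    have uE: "\<bar>u * E\<bar> \<le> \<eta> * (S + B) + C * G"
      using mult_left_mono[OF E' yv(2)]
      unfolding S_def B_def G_def yv(4)[symmetric] abs_mult v_def[symmetric]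
      by (simp add: algebra_simps power2_eq_square power3_eq_cube)
    have xE: "\<bar>x * c * E\<bar> \<le> \<eta> * (A + S) + C * y * B"
      using mult_left_mono[OF E', of "y * c"] c yv(1)
      unfolding A_def S_def B_def yv(3,4)[symmetric] abs_mult y_def[symmetric]
      by (simp add: algebra_simps power2_eq_square power3_eq_cube)
    have xuE: "\<bar>x * \<bar>u\<bar> * (a * x * c\<^sup>2 + b * c * u + E)\<bar> \<le> y * (\<bar>a\<bar> * S + \<bar>b\<bar> * B + (\<eta> * (S + B) + C * G))"
    proof -
      have "\<bar>u * (a * x * c\<^sup>2 + b * c * u + E)\<bar> \<le> \<bar>u * (a * x * c\<^sup>2)\<bar> + \<bar>u * (b * c * u)\<bar> + \<bar>u * E\<bar>"
        by (simp add: distrib_left)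
      also have "\<bar>u * (a * x * c\<^sup>2)\<bar> = \<bar>a\<bar> * S"
        by (simp add: abs_mult S_def y_def v_def)
      also have "\<bar>u * (b * c * u)\<bar> = \<bar>b\<bar> * B"
        using c by (simp add: abs_mult B_def power2_eq_square)
      finally have "\<bar>u * (a * x * c\<^sup>2 + b * c * u + E)\<bar> \<le> \<bar>a\<bar> * S + \<bar>b\<bar> * B + (\<eta> * (S + B) + C * G)"
        using uE by linarith
      from mult_left_mono[OF this yv(1)] show ?thesis
        by (simp add: abs_mult y_def mult.assoc)
    qed
    let ?U = "a * x * c\<^sup>2 + b * c * u + E"
    have T1: "sgn b * (u * ?U - a * x * c\<^sup>2 * u) \<ge> \<bar>b\<bar> * B - (\<eta> * (S + B) + C * G)"
    proof -
      have "sgn b * (u * ?U - a * x * c\<^sup>2 * u) = (sgn b * b) * B + sgn b * (u * E)"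
        by (simp add: algebra_simps B_def power2_eq_square)
      moreover have "\<bar>sgn b * (u * E)\<bar> = \<bar>u * E\<bar>" using \<open>b \<noteq> 0\<close> by (simp add: abs_mult)
      moreover have "sgn b * b = \<bar>b\<bar>" by (simp add: abs_sgn mult.commute)
      ultimately show ?thesis using uE by (simp only:)
    qed
    have T2: "n * c * u\<^sup>2 + x * c * ?U \<le> N * B - \<bar>a\<bar> * A + \<bar>b\<bar> * S + (\<eta> * (A + S) + C * y * B)"
    proof -
      have "n * c * u\<^sup>2 + x * c * ?U = N * B - \<bar>a\<bar> * A + b * (x * c\<^sup>2 * u) + x * c * E"
        using \<open>a < 0\<close> by (simp add: N_def A_def B_def algebra_simps power2_eq_square power3_eq_cube)
      moreover have "\<bar>b * (x * c\<^sup>2 * u)\<bar> = \<bar>b\<bar> * S" by (simp add: abs_mult S_def y_def v_def)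
      ultimately show ?thesis using xE by linarith
    qed
    have T3: "u\<^sup>2 * \<bar>u\<bar> + 2 * x * \<bar>u\<bar> * ?U \<ge> G - 2 * (y * (\<bar>a\<bar> * S + \<bar>b\<bar> * B + (\<eta> * (S + B) + C * G)))"
    proof -
      have "u\<^sup>2 * \<bar>u\<bar> = G"
        unfolding G_def yv(4)[symmetric] v_def[symmetric] by (simp only: power3_eq_cube power2_eq_square)
      moreover have "2 * x * \<bar>u\<bar> * ?U = 2 * (x * \<bar>u\<bar> * ?U)" by simp
      ultimately show ?thesis using xuE by linarith
    qed
    define e1 e2 where "e1 = \<eta> * \<epsilon>" and "e2 = y * K"
    have e: "0 \<le> e1" "e1 \<le> \<eta> / 4" "0 \<le> e2" "0 \<le> y * C * \<epsilon>" "y * C * \<epsilon> \<le> y * C"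
      using \<epsilon> \<eta> K yv \<open>0 \<le> C\<close> mult_left_mono[OF \<epsilon>(2), of \<eta>]
      by (auto simp: e1_def e2_def intro!: mult_left_le)
    have yD: "y * C + 2 * e2 * (\<bar>a\<bar> + \<bar>b\<bar> + 2 + C) \<le> \<kappa>"
      using mD[of y] x by (simp add: D_def y_def e2_def algebra_simps)
    have q: "0 \<le> e2 * \<bar>a\<bar>" "0 \<le> e2 * \<bar>b\<bar>" "0 \<le> e2 * C" "0 \<le> y * C" "e2 * \<eta> \<le> e2" "0 \<le> e2 * \<eta>"
      using e yv \<open>0 \<le> C\<close> \<eta> by (auto intro: mult_left_le)
    have yD': "y * C + 2 * (e2 * \<bar>a\<bar>) + 2 * (e2 * \<bar>b\<bar>) + 4 * e2 + 2 * (e2 * C) \<le> \<kappa>"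
      using yD by (simp add: algebra_simps)
    \<comment> \<open>\<open>t\<close> is the total coefficient of \<open>S\<close> apart from
      \<open>\<epsilon> |b|\<close>. Since it is small, the plain bound \<open>S \<le> A + B\<close>
      suffices for it, and what remains is a comparison of coefficients of \<open>A\<close>,
      \<open>B\<close> and \<open>G\<close>.\<close>
    define t \<beta> where "t = \<eta> + e1 + 2 * e2 * \<bar>a\<bar> + 2 * e2 * \<eta>" and "\<beta> = b\<^sup>2 / \<bar>a\<bar>"
    have t: "t = \<eta> + e1 + 2 * (e2 * \<bar>a\<bar>) + 2 * (e2 * \<eta>)" "0 \<le> t"
      using \<eta> e q by (simp_all add: t_def)
    have "t * S \<le> t * (A + B)" using S t(2) by (rule mult_left_mono)
    then have sS: "t * S \<le> t * A + t * B" by (simp only: distrib_left)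
    have "\<kappa> \<le> 3/4 * (\<epsilon> * \<bar>a\<bar>) - e1 - t" unfolding t(1) using \<kappa> \<eta> e q yD' by linarith
    from mult_right_mono[OF this nn(1)]
    have cA: "\<kappa> * A \<le> 3/4 * (\<epsilon> * \<bar>a\<bar> * A) - e1 * A - t * A" by (simp add: left_diff_distrib)
    have "\<kappa> \<le> 3/4 * \<bar>b\<bar> - \<eta> - y * C * \<epsilon> - 2 * (e2 * \<bar>b\<bar>) - 2 * (e2 * \<eta>) - t"
      unfolding t(1) using \<kappa> \<eta> e q yD' by linarith
    from mult_right_mono[OF this nn(2)]
    have cB: "\<kappa> * B \<le> 3/4 * (\<bar>b\<bar> * B) - \<eta> * B - y * C * \<epsilon> * B - 2 * (e2 * \<bar>b\<bar> * B) - 2 * (e2 * \<eta> * B) - t * B"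
      by (simp add: left_diff_distrib)
    have "\<kappa> \<le> K - C - 2 * (e2 * C)"
      unfolding K_def using \<kappa> \<eta> e q yD' by linarith
    from mult_right_mono[OF this nn(4)]
    have cG: "\<kappa> * G \<le> K * G - C * G - 2 * (e2 * C * G)" by (simp add: left_diff_distrib)
    have "\<epsilon> * (\<bar>b\<bar> * S) \<le> \<epsilon> * (\<bar>a\<bar> / 4 * A + \<beta> * B)"
      using bS \<epsilon>(1) unfolding \<beta>_def by (intro mult_left_mono) auto
    then have bS': "\<epsilon> * \<bar>b\<bar> * S \<le> 1/4 * (\<epsilon> * \<bar>a\<bar> * A) + \<epsilon> * \<beta> * B" by (simp add: distrib_left)
    have "\<epsilon> * (N + \<beta>) * B \<le> \<bar>b\<bar> / 4 * B"
      using \<epsilon>b nn(2) unfolding \<beta>_def by (rule mult_right_mono)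
    then have \<epsilon>b': "\<epsilon> * N * B + \<epsilon> * \<beta> * B \<le> 1/4 * (\<bar>b\<bar> * B)" by (simp add: distrib_left distrib_right)
    have T2': "\<epsilon> * (real n * c * u\<^sup>2 + x * c * ?U) \<le>
        \<epsilon> * (N * B - \<bar>a\<bar> * A + \<bar>b\<bar> * S + (\<eta> * (A + S) + C * y * B))"
      using T2 \<epsilon> by (intro mult_left_mono) auto
    have T3': "K * (u\<^sup>2 * \<bar>u\<bar> + 2 * x * \<bar>u\<bar> * ?U) \<ge>
        K * (G - 2 * (y * (\<bar>a\<bar> * S + \<bar>b\<bar> * B + (\<eta> * (S + B) + C * G))))"
      using T3 K by (intro mult_left_mono) auto
    have tS: "t * S = \<eta> * S + e1 * S + 2 * (e2 * \<bar>a\<bar> * S) + 2 * (e2 * \<eta> * S)"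
      unfolding t(1) by (simp add: distrib_right)
    have "\<kappa> * A + \<kappa> * B + \<kappa> * G \<le> \<bar>b\<bar> * B - \<eta> * S - \<eta> * B - C * G
        - \<epsilon> * N * B + \<epsilon> * \<bar>a\<bar> * A - \<epsilon> * \<bar>b\<bar> * S - e1 * A - e1 * S - y * C * \<epsilon> * B
        + K * G - 2 * (e2 * \<bar>a\<bar> * S) - 2 * (e2 * \<bar>b\<bar> * B) - 2 * (e2 * \<eta> * S) - 2 * (e2 * \<eta> * B) - 2 * (e2 * C * G)"
      using cA cB cG bS' \<epsilon>b' sS tS by linarith
    also have "\<dots> = \<bar>b\<bar> * B - (\<eta> * (S + B) + C * G)
        - \<epsilon> * (N * B - \<bar>a\<bar> * A + \<bar>b\<bar> * S + (\<eta> * (A + S) + C * y * B))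
        + K * (G - 2 * (y * (\<bar>a\<bar> * S + \<bar>b\<bar> * B + (\<eta> * (S + B) + C * G))))"
      unfolding e1_def e2_def by (simp add: algebra_simps)
    finally have "\<kappa> * (A + B + G) \<le> \<bar>b\<bar> * B - (\<eta> * (S + B) + C * G)
        - \<epsilon> * (N * B - \<bar>a\<bar> * A + \<bar>b\<bar> * S + (\<eta> * (A + S) + C * y * B))
        + K * (G - 2 * (y * (\<bar>a\<bar> * S + \<bar>b\<bar> * B + (\<eta> * (S + B) + C * G))))"
      by (simp only: distrib_left)
    then have "\<kappa> * (A + B + G) \<le> sgn b * (u * ?U - a * x * c\<^sup>2 * u)
       - \<epsilon> * (real n * c * u\<^sup>2 + x * c * ?U) + K * (u\<^sup>2 * \<bar>u\<bar> + 2 * x * \<bar>u\<bar> * ?U)"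
      using T1 T2' T3' by linarith
    then show ?thesis unfolding A_def B_def G_def v_def .
  qed
  \<comment> \<open>The energy is \<open>u^2 / 2 + |a| z^2 / (2 N)\<close> with
    \<open>z = x * c\<close>; the correction terms consume at most half of each square.\<close>
  have pos: "0 < u\<^sup>2 / 2 - a * (x * c)\<^sup>2 / (2 * real n) + sgn b * (K * x * (u * \<bar>u\<bar>) - \<epsilon> * (x * c) * u)"
    if x: "\<bar>x\<bar> \<le> m" and nz: "u \<noteq> 0 \<or> x * c \<noteq> 0" for x u c
  proof -
    define z where "z = x * c"
    have 1: "\<bar>K * x * (u * \<bar>u\<bar>)\<bar> \<le> 1/8 * u\<^sup>2"
    proof -
      have "\<bar>K * x * (u * \<bar>u\<bar>)\<bar> = (\<bar>x\<bar> * K) * u\<^sup>2"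
        using K by (simp add: abs_mult power2_eq_square)
      also have "\<dots> \<le> 1/8 * u\<^sup>2" using mK[OF x] by (intro mult_right_mono) auto
      finally show ?thesis .
    qed
    have "2 * (\<bar>z\<bar> * \<bar>u\<bar>) \<le> z\<^sup>2 + u\<^sup>2"
      using sum_squares_bound[of "\<bar>z\<bar>" "\<bar>u\<bar>"] by simp
    then have "\<epsilon> / 2 * (2 * (\<bar>z\<bar> * \<bar>u\<bar>)) \<le> \<epsilon> / 2 * (z\<^sup>2 + u\<^sup>2)"
      using \<epsilon> by (intro mult_left_mono) auto
    then have 2: "\<bar>\<epsilon> * z * u\<bar> \<le> \<epsilon> / 2 * z\<^sup>2 + \<epsilon> / 2 * u\<^sup>2"
      using \<epsilon> by (simp add: abs_mult algebra_simps)
    have 3: "\<epsilon> / 2 * z\<^sup>2 \<le> \<bar>a\<bar> / (4 * N) * z\<^sup>2" using \<epsilon>a by (rule mult_right_mono) simp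
    have 4: "\<epsilon> / 2 * u\<^sup>2 \<le> 1/8 * u\<^sup>2" using \<epsilon> by (intro mult_right_mono) auto
    have "\<bar>sgn b * (K * x * (u * \<bar>u\<bar>) - \<epsilon> * z * u)\<bar> = \<bar>K * x * (u * \<bar>u\<bar>) - \<epsilon> * z * u\<bar>"
      using \<open>b \<noteq> 0\<close> by (simp add: abs_mult)
    also have "\<dots> \<le> 1/4 * u\<^sup>2 + \<bar>a\<bar> / (4 * N) * z\<^sup>2" using 1 2 3 4 by linarith
    finally have 5: "\<bar>sgn b * (K * x * (u * \<bar>u\<bar>) - \<epsilon> * z * u)\<bar> \<le> 1/4 * u\<^sup>2 + \<bar>a\<bar> / (4 * N) * z\<^sup>2" .
    have 6: "- a * z\<^sup>2 / (2 * N) = 2 * (\<bar>a\<bar> / (4 * N) * z\<^sup>2)" using \<open>a < 0\<close> N by (simp add: field_simps)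
    have aN: "0 < \<bar>a\<bar> / (4 * N)" using N \<open>a < 0\<close> by (intro divide_pos_pos) simp_all
    have "0 < 1/4 * u\<^sup>2 + \<bar>a\<bar> / (4 * N) * z\<^sup>2"
    proof (cases "u = 0")
      case True
      then have "0 < z\<^sup>2" using nz by (simp add: z_def)
      then show ?thesis using True mult_pos_pos[OF aN] by simp
    next
      case False
      then show ?thesis using mult_nonneg_nonneg[OF less_imp_le[OF aN], of "z\<^sup>2"]
        by (intro add_pos_nonneg) simp_all
    qed
    then have "0 < u\<^sup>2 / 2 - a * z\<^sup>2 / (2 * N) + sgn b * (K * x * (u * \<bar>u\<bar>) - \<epsilon> * z * u)"
      using 5 6 by linarith
    then show ?thesis unfolding z_def N_def .
  qed
  show thesis
    by (rule that[OF \<eta>(1) \<kappa>(1) m]; intro allI impI) (rule decay pos; assumption)+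
qed

section \<open>Expansion of the derivative of \<open>u\<close> along the flow\<close>

lemma mvt_segment:
  fixes g g' :: "real \<Rightarrow> real"
  assumes "\<And>s. s \<in> closed_segment a b \<Longrightarrow> (g has_real_derivative g' s) (at s)"
  obtains \<xi> where "\<xi> \<in> closed_segment a b" "g b - g a = (b - a) * g' \<xi>"
proof -
  consider "a < b" | "b < a" | "a = b" by linarith
  then show thesis
  proof cases
    case 1
    then obtain z where "a < z" "z < b" "g b - g a = (b - a) * g' z"
      using MVT2[of a b g g'] assms by (auto simp: closed_segment_eq_real_ivl)
    then show thesis using that[of z] by (auto simp: closed_segment_eq_real_ivl)
  next
    case 2
    then obtain z where "b < z" "z < a" "g a - g b = (a - b) * g' z"
      using MVT2[of b a g g'] assms by (auto simp: closed_segment_eq_real_ivl)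
    then show thesis using that[of z] by (auto simp: closed_segment_eq_real_ivl algebra_simps)
  next
    case 3
    then show thesis using that[of a] by simp
  qed
qed

text \<open>The intermediate point is kept within \<open>|z - y|\<close> of both ends so that
  Lipschitz bounds can compare \<open>fy\<close> there with its value at either end.\<close>

lemma mvt_snd:
  fixes f fx fy :: "real \<times> real \<Rightarrow> real"
  assumes f: "\<And>p. p \<in> S \<Longrightarrow> (f has_derivative (\<lambda>h. fst h * fx p + snd h * fy p)) (at p)"
    and "convex S" "(x, y) \<in> S" "(x, z) \<in> S"
  shows "\<exists>\<xi>. (x, \<xi>) \<in> S \<and> \<bar>\<xi> - y\<bar> \<le> \<bar>z - y\<bar> \<and> \<bar>\<xi> - z\<bar> \<le> \<bar>z - y\<bar> \<and>
    f (x, z) - f (x, y) = (z - y) * fy (x, \<xi>)"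
proof -
  have seg: "(x, s) \<in> S" if "s \<in> closed_segment y z" for s
  proof -
    from that obtain t where "0 \<le> t" "t \<le> 1" "s = (1 - t) * y + t * z"
      by (auto simp: closed_segment_def)
    then have "(x, s) = (1 - t) *\<^sub>R (x, y) + t *\<^sub>R (x, z)" by (simp add: algebra_simps)
    then show ?thesis
      using convexD_alt[OF \<open>convex S\<close> \<open>(x, y) \<in> S\<close> \<open>(x, z) \<in> S\<close> \<open>0 \<le> t\<close> \<open>t \<le> 1\<close>] by simp
  qed
  have "((\<lambda>s. f (x, s)) has_real_derivative fy (x, s)) (at s)" if "s \<in> closed_segment y z" for s
  proof -
    have "((\<lambda>s. (x, s)) has_derivative (\<lambda>h. (0, h))) (at s)"
      by (auto intro!: derivative_eq_intros)
    from has_derivative_compose[OF this f[OF seg[OF that]]]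
    show ?thesis by (simp add: has_field_derivative_def mult_commute_abs)
  qed
  from mvt_segment[OF this] obtain \<xi> where \<xi>: "\<xi> \<in> closed_segment y z"
    "f (x, z) - f (x, y) = (z - y) * fy (x, \<xi>)" by blast
  moreover have "\<bar>\<xi> - y\<bar> \<le> \<bar>z - y\<bar>" "\<bar>\<xi> - z\<bar> \<le> \<bar>z - y\<bar>"
    using \<xi>(1) by (auto simp: closed_segment_eq_real_ivl split: if_splits)
  ultimately show ?thesis using seg[OF \<xi>(1)] by blast
qed

text \<open>Along the flow \<open>u' = Q + u Px + Q Py\<close>. Everything is compared with the
  point \<open>(x, F x)\<close> on the same vertical line, so \<open>F\<close> is only evaluated.
  With \<open>w = y - F x\<close> the mean value theorem makes \<open>u\<close> and
  \<open>Q - f\<close> multiples of \<open>w\<close>; the part linear in \<open>u\<close> has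
  coefficient \<open>\<Phi>(x)\<close>, and the differences of partial derivatives are
  \<open>O(w)\<close>, hence contribute \<open>O(u^2)\<close>.\<close>

lemma velocity_derivative_expansion:
  fixes P Q Px Py Qx Qy :: "real \<times> real \<Rightarrow> real" and F :: "real \<Rightarrow> real"
  assumes "0 < R" "0 < L"
    and P: "\<And>p. p \<in> cball 0 R \<Longrightarrow> (P has_derivative (\<lambda>h. fst h * Px p + snd h * Py p)) (at p)"
    and Q: "\<And>p. p \<in> cball 0 R \<Longrightarrow> (Q has_derivative (\<lambda>h. fst h * Qx p + snd h * Qy p)) (at p)"
    and lip: "\<And>g p q. g \<in> {Px, Py, Qy} \<Longrightarrow> p \<in> cball 0 R \<Longrightarrow> q \<in> cball 0 R \<Longrightarrow> \<bar>g p - g q\<bar> \<le> L * norm (p - q)"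
    and zero: "Py 0 = 0" "Qy 0 = 0"
    and F: "F 0 = 0" "isCont F 0" "\<forall>\<^sub>F x in nhds 0. F x + P (x, F x) = 0"
    and f: "\<And>\<eta>. 0 < \<eta> \<Longrightarrow> \<forall>\<^sub>F x in nhds 0. \<bar>Q (x, F x) - a * x ^ k\<bar> \<le> \<eta> * \<bar>x\<bar> ^ k"
    and \<Phi>: "\<And>\<eta>. 0 < \<eta> \<Longrightarrow> \<forall>\<^sub>F x in nhds 0. \<bar>Px (x, F x) + Qy (x, F x) - b * x ^ l\<bar> \<le> \<eta> * \<bar>x\<bar> ^ l"
    and "0 < \<eta>"
  obtains \<rho> where "0 < \<rho>" "\<rho> \<le> R"
    "\<forall>x y u. (x, y) \<in> cball 0 \<rho> \<longrightarrow> u = y + P (x, y) \<longrightarrow>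
       \<bar>Q (x, y) + u * Px (x, y) + Q (x, y) * Py (x, y) - (a * x ^ k + b * x ^ l * u)\<bar>
         \<le> \<eta> * (\<bar>x\<bar> ^ k + \<bar>x\<bar> ^ l * \<bar>u\<bar>) + 12 * L * u\<^sup>2"
proof -
  \<comment> \<open>\<open>\<zeta>\<close> will bound \<open>Py\<close> and \<open>Qy\<close>. The
    value \<open>1/2\<close> gives \<open>|w| \<le> 2 |u|\<close>; the other bound keeps the product
    of \<open>Py\<close> with \<open>f\<close>, where \<open>|f| \<le> (|a| + 1) |x|^k\<close>,
    below \<open>\<eta>/2 |x|^k\<close>. The other half of \<open>\<eta>\<close> is reserved for
    \<open>f - a x^k\<close> through \<open>\<mu>\<close>.\<close>
  define \<zeta> where "\<zeta> = min (1/2) (\<eta> / (2 * (\<bar>a\<bar> + 1)))"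
  define R' where "R' = min R (\<zeta> / L)"
  define \<mu> where "\<mu> = min 1 (\<eta> / 2)"
  have \<zeta>: "0 < \<zeta>" "\<zeta> \<le> 1/2" "\<zeta> * (\<bar>a\<bar> + 1) \<le> \<eta> / 2"
  proof -
    have "0 < \<eta> / (2 * (\<bar>a\<bar> + 1))" using \<open>0 < \<eta>\<close> by (intro divide_pos_pos) auto
    then show "0 < \<zeta>" "\<zeta> \<le> 1/2" unfolding \<zeta>_def by linarith+
    have "\<zeta> * (\<bar>a\<bar> + 1) \<le> \<eta> / (2 * (\<bar>a\<bar> + 1)) * (\<bar>a\<bar> + 1)"
      by (rule mult_right_mono) (auto simp: \<zeta>_def)
    also have "\<dots> = \<eta> / 2" by (simp add: field_simps)
    finally show "\<zeta> * (\<bar>a\<bar> + 1) \<le> \<eta> / 2" .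
  qed
  have \<mu>: "0 < \<mu>" "\<mu> \<le> 1" "\<mu> \<le> \<eta> / 2" using \<open>0 < \<eta>\<close> by (auto simp: \<mu>_def)
  have R': "0 < R'" "R' \<le> R" using \<open>0 < R\<close> \<open>0 < L\<close> \<zeta> by (auto simp: R'_def)
  have small: "\<bar>g p\<bar> \<le> \<zeta>" if "p \<in> cball 0 R'" "g = Py \<or> g = Qy" for g p
  proof -
    have "\<bar>g p - g 0\<bar> \<le> L * norm (p - 0)"
      using that R' \<open>0 < R\<close> by (intro lip) auto
    also have "\<dots> \<le> L * (\<zeta> / L)"
      using that \<open>0 < L\<close> by (intro mult_left_mono) (auto simp: R'_def)
    finally show ?thesis using that zero \<open>0 < L\<close> by auto
  qed
  have "isCont (\<lambda>x. norm (x, F x)) 0" using F(2) by (intro continuous_intros)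
  then have "((\<lambda>x. norm (x, F x)) \<longlongrightarrow> 0) (nhds 0)"
    using F(1) by (simp add: isCont_def tendsto_nhds_iff)
  then have "\<forall>\<^sub>F x in nhds 0. norm (x, F x) < R'"
    using R'(1) by (rule order_tendstoD)
  from eventually_conj[OF this eventually_conj[OF F(3) eventually_conj[OF f[OF \<mu>(1)] \<Phi>[OF \<open>0 < \<eta>\<close>]]]]
  obtain d where "0 < d" and d: "\<And>x. \<bar>x\<bar> < d \<Longrightarrow> norm (x, F x) < R' \<and> F x + P (x, F x) = 0 \<and>
      \<bar>Q (x, F x) - a * x ^ k\<bar> \<le> \<mu> * \<bar>x\<bar> ^ k \<and>
      \<bar>Px (x, F x) + Qy (x, F x) - b * x ^ l\<bar> \<le> \<eta> * \<bar>x\<bar> ^ l"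
    unfolding eventually_nhds_metric by (auto simp: dist_real_def)
  show thesis
  proof (rule that[of "min R' (d / 2)"]; (intro allI impI)?)
    show "0 < min R' (d / 2)" "min R' (d / 2) \<le> R" using R' \<open>0 < d\<close> by auto
    fix x y u
    assume xy: "(x, y) \<in> cball 0 (min R' (d / 2))" and u: "u = y + P (x, y)"
    then have inR': "(x, y) \<in> cball 0 R'" by simp
    have "\<bar>x\<bar> \<le> norm (x, y)" using norm_fst_le[of x y] by simp
    then have "\<bar>x\<bar> < d" using xy \<open>0 < d\<close> by auto
    note dx = d[OF this]
    define w where "w = y - F x"
    have inF: "(x, F x) \<in> cball 0 R'" using dx by simp
    have sub: "cball 0 R' \<subseteq> cball (0 :: real \<times> real) R" using R' by auto
    have PR': "(P has_derivative (\<lambda>h. fst h * Px p + snd h * Py p)) (at p)" if "p \<in> cball 0 R'" for p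
      using P sub that by blast
    have QR': "(Q has_derivative (\<lambda>h. fst h * Qx p + snd h * Qy p)) (at p)" if "p \<in> cball 0 R'" for p
      using Q sub that by blast
    have "\<exists>\<xi>. (x, \<xi>) \<in> cball 0 R' \<and> \<bar>\<xi> - F x\<bar> \<le> \<bar>w\<bar> \<and> \<bar>\<xi> - y\<bar> \<le> \<bar>w\<bar> \<and>
        P (x, y) - P (x, F x) = w * Py (x, \<xi>)"
      unfolding w_def by (rule mvt_snd[of _ _ Px]) (fact PR', rule convex_cball, fact inF, fact inR')
    then obtain \<xi> where \<xi>: "(x, \<xi>) \<in> cball 0 R'" "\<bar>\<xi> - F x\<bar> \<le> \<bar>w\<bar>" "\<bar>\<xi> - y\<bar> \<le> \<bar>w\<bar>"
      "P (x, y) - P (x, F x) = w * Py (x, \<xi>)" by blast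
    have "\<exists>\<tau>. (x, \<tau>) \<in> cball 0 R' \<and> \<bar>\<tau> - F x\<bar> \<le> \<bar>w\<bar> \<and> \<bar>\<tau> - y\<bar> \<le> \<bar>w\<bar> \<and>
        Q (x, y) - Q (x, F x) = w * Qy (x, \<tau>)"
      unfolding w_def by (rule mvt_snd[of _ _ Qx]) (fact QR', rule convex_cball, fact inF, fact inR')
    then obtain \<tau> where \<tau>: "(x, \<tau>) \<in> cball 0 R'" "\<bar>\<tau> - F x\<bar> \<le> \<bar>w\<bar>" "\<bar>\<tau> - y\<bar> \<le> \<bar>w\<bar>"
      "Q (x, y) - Q (x, F x) = w * Qy (x, \<tau>)" by blast
    define f0 p1 p2 q0 q2 px px0 where "f0 = Q (x, F x)" and "p1 = Py (x, y)" and "p2 = Py (x, \<xi>)"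
      and "q0 = Qy (x, F x)" and "q2 = Qy (x, \<tau>)" and "px = Px (x, y)" and "px0 = Px (x, F x)"
    have uw: "u = (1 + p2) * w"
      using \<xi>(4) dx u by (simp add: w_def p2_def algebra_simps)
    have Qxy: "Q (x, y) = f0 + w * q2" using \<tau>(4) by (simp add: f0_def q2_def)
    have sm: "\<bar>p1\<bar> \<le> \<zeta>" "\<bar>p2\<bar> \<le> \<zeta>" "\<bar>q2\<bar> \<le> \<zeta>"
      using small inR' \<xi> \<tau> by (auto simp: p1_def p2_def q2_def)
    have "1/2 * \<bar>w\<bar> \<le> \<bar>1 + p2\<bar> * \<bar>w\<bar>" using sm(2) \<zeta> by (intro mult_right_mono) auto
    then have wu: "\<bar>w\<bar> \<le> 2 * \<bar>u\<bar>" by (simp add: uw abs_mult)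
    have lipx: "\<bar>g (x, s) - g (x, t)\<bar> \<le> L * \<bar>s - t\<bar>"
      if "g \<in> {Px, Py, Qy}" "(x, s) \<in> cball 0 R'" "(x, t) \<in> cball 0 R'" for g s t
    proof -
      have "\<bar>g (x, s) - g (x, t)\<bar> \<le> L * norm ((x, s) - (x, t))"
        by (rule lip[OF that(1)]) (use that sub in blast)+
      then show ?thesis by (simp add: norm_Pair)
    qed
    have lw: "L * s \<le> L * \<bar>w\<bar>" if "s \<le> \<bar>w\<bar>" for s
      using that less_imp_le[OF \<open>0 < L\<close>] by (rule mult_left_mono)
    have d1: "\<bar>p1 - p2\<bar> \<le> L * \<bar>w\<bar>"
      using lipx[of Py y \<xi>] inR' \<xi> lw[of "\<bar>y - \<xi>\<bar>"] by (simp add: p1_def p2_def abs_minus_commute)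
    have d2: "\<bar>q2 - q0\<bar> \<le> L * \<bar>w\<bar>"
      using lipx[of Qy \<tau> "F x"] inF \<tau> lw[of "\<bar>\<tau> - F x\<bar>"] by (simp add: q2_def q0_def)
    have d3: "\<bar>px - px0\<bar> \<le> L * \<bar>w\<bar>"
      using lipx[of Px y "F x"] inF inR' by (simp add: px_def px0_def w_def)
    have w2: "w\<^sup>2 \<le> 4 * u\<^sup>2"
      using power_mono[OF wu, of 2] by (simp add: power_mult_distrib)
    \<comment> \<open>\<open>E1\<close> is the error of \<open>f\<close> and \<open>E3\<close> that
      of \<open>\<Phi>\<close>. In \<open>E2\<close> each summand is a difference of partial
      derivatives times \<open>w\<close> or \<open>u\<close>: the first bracket gives
      \<open>5/2 L w^2 \<le> 10 L u^2\<close>, the last term \<open>2 L u^2\<close>, which explains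
      the constant 12.\<close>
    define E1 E2 E3 where "E1 = (f0 - a * x ^ k) + p1 * f0"
      and "E2 = w * ((p1 - p2) * q2 + (1 + p2) * (q2 - q0)) + (px - px0) * u"
      and "E3 = (px0 + q0 - b * x ^ l) * u"
    have eq: "Q (x, y) + u * px + Q (x, y) * p1 - (a * x ^ k + b * x ^ l * u) = E1 + E2 + E3"
      unfolding E1_def E2_def E3_def Qxy uw by (simp only: algebra_simps)
    have E1: "\<bar>E1\<bar> \<le> \<eta> * \<bar>x\<bar> ^ k"
    proof -
      have h: "\<bar>f0 - a * x ^ k\<bar> \<le> \<mu> * \<bar>x\<bar> ^ k" using dx unfolding f0_def by blast
      have "\<bar>a * x ^ k\<bar> = \<bar>a\<bar> * \<bar>x\<bar> ^ k" by (simp add: abs_mult power_abs)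
      then have "\<bar>f0\<bar> \<le> \<mu> * \<bar>x\<bar> ^ k + \<bar>a\<bar> * \<bar>x\<bar> ^ k" using h by linarith
      also have "\<dots> \<le> (\<bar>a\<bar> + 1) * \<bar>x\<bar> ^ k"
        using mult_right_mono[OF \<mu>(2), of "\<bar>x\<bar> ^ k"] by (simp add: distrib_right)
      finally have "\<bar>p1\<bar> * \<bar>f0\<bar> \<le> \<zeta> * ((\<bar>a\<bar> + 1) * \<bar>x\<bar> ^ k)"
        using sm(1) \<zeta> by (intro mult_mono) auto
      also have "\<dots> \<le> \<eta> / 2 * \<bar>x\<bar> ^ k"
        using mult_right_mono[OF \<zeta>(3), of "\<bar>x\<bar> ^ k"] by (simp add: mult.assoc)
      finally have "\<bar>p1 * f0\<bar> \<le> \<eta> / 2 * \<bar>x\<bar> ^ k" by (simp add: abs_mult)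
      moreover have "\<mu> * \<bar>x\<bar> ^ k \<le> \<eta> / 2 * \<bar>x\<bar> ^ k" using \<mu>(3) by (rule mult_right_mono) simp
      ultimately show ?thesis using h unfolding E1_def by (simp add: field_simps) 
    qed
    have E2: "\<bar>E2\<bar> \<le> 12 * L * u\<^sup>2"
    proof -
      have "\<bar>(p1 - p2) * q2\<bar> \<le> L * \<bar>w\<bar> * 1"
        unfolding abs_mult using d1 sm(3) \<zeta> by (intro mult_mono) auto
      moreover have "\<bar>(1 + p2) * (q2 - q0)\<bar> \<le> 3/2 * (L * \<bar>w\<bar>)"
        unfolding abs_mult using d2 sm(2) \<zeta> by (intro mult_mono) auto
      ultimately have "\<bar>(p1 - p2) * q2 + (1 + p2) * (q2 - q0)\<bar> \<le> 5/2 * (L * \<bar>w\<bar>)" by linarith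
      then have "\<bar>w\<bar> * \<bar>(p1 - p2) * q2 + (1 + p2) * (q2 - q0)\<bar> \<le> \<bar>w\<bar> * (5/2 * (L * \<bar>w\<bar>))"
        by (rule mult_left_mono) simp
      also have "\<dots> = 5/2 * L * w\<^sup>2" unfolding power2_abs[of w, symmetric] power2_eq_square by (simp only: ac_simps)
      also have "\<dots> \<le> 5/2 * L * (4 * u\<^sup>2)" using w2 \<open>0 < L\<close> by (intro mult_left_mono) auto
      finally have 1: "\<bar>w * ((p1 - p2) * q2 + (1 + p2) * (q2 - q0))\<bar> \<le> 10 * L * u\<^sup>2"
        by (simp add: abs_mult)
      have "L * \<bar>w\<bar> \<le> L * (2 * \<bar>u\<bar>)"
        using wu less_imp_le[OF \<open>0 < L\<close>] by (rule mult_left_mono)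
      then have "\<bar>px - px0\<bar> * \<bar>u\<bar> \<le> (L * (2 * \<bar>u\<bar>)) * \<bar>u\<bar>"
        using d3 by (intro mult_right_mono) auto
      also have "\<dots> = 2 * L * u\<^sup>2" unfolding power2_abs[of u, symmetric] power2_eq_square by (simp only: ac_simps)
      finally have 2: "\<bar>(px - px0) * u\<bar> \<le> 2 * L * u\<^sup>2" by (simp add: abs_mult)
      show ?thesis using 1 2 unfolding E2_def by linarith
    qed
    have E3: "\<bar>E3\<bar> \<le> \<eta> * (\<bar>x\<bar> ^ l * \<bar>u\<bar>)"
      unfolding E3_def abs_mult px0_def q0_def
      using mult_right_mono[OF conjunct2[OF conjunct2[OF conjunct2[OF dx]]], of "\<bar>u\<bar>"] by simp
    have "\<bar>E1 + E2 + E3\<bar> \<le> \<eta> * \<bar>x\<bar> ^ k + \<eta> * (\<bar>x\<bar> ^ l * \<bar>u\<bar>) + 12 * L * u\<^sup>2"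
      using E1 E2 E3 by linarith
    then show "\<bar>Q (x, y) + u * Px (x, y) + Q (x, y) * Py (x, y) - (a * x ^ k + b * x ^ l * u)\<bar>
         \<le> \<eta> * (\<bar>x\<bar> ^ k + \<bar>x\<bar> ^ l * \<bar>u\<bar>) + 12 * L * u\<^sup>2"
      by (simp only: px_def[symmetric] p1_def[symmetric] eq distrib_left)
  qed
qed

text \<open>At 0 the difference quotient is \<open>|h|\<close>; elsewhere the function is locally
  \<open>sgn x * y^2\<close>. This makes the \<open>K\<close> term of \<open>V\<close>
  differentiable across \<open>u = 0\<close>.\<close>

lemma has_real_derivative_mult_abs: "((\<lambda>x::real. x * \<bar>x\<bar>) has_real_derivative 2 * \<bar>x\<bar>) (at x)"
proof (cases "x = 0")
  case True
  have "((\<lambda>h. \<bar>h\<bar>) \<longlongrightarrow> 0) (at (0::real))" by (auto intro!: tendsto_eq_intros)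
  then have "((\<lambda>h::real. (h * \<bar>h\<bar>) / h) \<longlongrightarrow> 0) (at 0)"
    by (rule Lim_transform_eventually) (auto simp: eventually_at_filter)
  then show ?thesis using True by (simp add: DERIV_def)
next
  case False
  have "((\<lambda>y. sgn x * y\<^sup>2) has_real_derivative 2 * \<bar>x\<bar>) (at x)"
    by (auto intro!: derivative_eq_intros simp: abs_sgn)
  moreover have "open ((\<lambda>y. x * y) -` {0<..})" by (intro open_vimage continuous_intros)
  ultimately show ?thesis
  proof (rule has_field_derivative_transform_within_open)
    show "x \<in> (\<lambda>y. x * y) -` {0<..}" using False by (auto simp: zero_less_mult_iff)
    fix y assume "y \<in> (\<lambda>y. x * y) -` {0<..}"
    then show "sgn x * y\<^sup>2 = y * \<bar>y\<bar>"
      by (auto simp: zero_less_mult_iff power2_eq_square)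
  qed
qed

text \<open>By the mean value theorem \<open>P (0, y)\<close> is at most half of \<open>y\<close> in
  size. On the \<open>y\<close>-axis this shows that \<open>u\<close> vanishes only at the origin,
  needed for definiteness, and that \<open>x' > 0\<close> for \<open>y > 0\<close>, needed for the
  sense of rotation.\<close>

lemma axis_velocity:
  fixes P Px Py :: "real \<times> real \<Rightarrow> real"
  assumes P: "\<And>p. p \<in> cball 0 R \<Longrightarrow> (P has_derivative (\<lambda>h. fst h * Px p + snd h * Py p)) (at p)"
    and Py: "\<And>p. p \<in> cball 0 R \<Longrightarrow> \<bar>Py p\<bar> \<le> 1/2" and "P 0 = 0" "\<bar>y\<bar> \<le> R"
  obtains t where "1/2 \<le> t" "y + P (0, y) = t * y"
proof -
  have "\<exists>\<xi>. (0::real, \<xi>) \<in> cball 0 R \<and> \<bar>\<xi> - 0\<bar> \<le> \<bar>y - 0\<bar> \<and> \<bar>\<xi> - y\<bar> \<le> \<bar>y - 0\<bar> \<and>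
      P (0, y) - P (0, 0) = (y - 0) * Py (0, \<xi>)"
    by (rule mvt_snd[of _ _ Px]) (fact P, rule convex_cball, use \<open>\<bar>y\<bar> \<le> R\<close> in auto)
  then obtain \<xi> where \<xi>: "(0::real, \<xi>) \<in> cball 0 R" "P (0, y) - P (0, 0) = (y - 0) * Py (0, \<xi>)" by blast
  have "P (0, 0) = 0" using \<open>P 0 = 0\<close> by (simp add: zero_prod_def)
  then have "y + P (0, y) = (1 + Py (0, \<xi>)) * y" using \<xi>(2) by (simp add: distrib_right)
  moreover have "1/2 \<le> 1 + Py (0, \<xi>)" using Py[OF \<xi>(1)] by linarith
  ultimately show thesis by (intro that)
qed

text \<open>The algebraic estimate is applied with \<open>c = x^(n-1)\<close> and
  \<open>C = 12 * L\<close>, the constant of the expansion. Stating the decay for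
  \<open>- sgn b *\<^sub>R X\<close> covers both signs of \<open>b\<close>.\<close>

lemma nilpotent_lyapunov_function:
  fixes P Q Px Py Qx Qy :: "real \<times> real \<Rightarrow> real" and F :: "real \<Rightarrow> real"
  defines "X \<equiv> nilpotent_system P Q"
  assumes "0 < R" "0 < L" "odd n" "a < 0" "b \<noteq> 0"
    and P: "\<And>p. p \<in> cball 0 R \<Longrightarrow> (P has_derivative (\<lambda>h. fst h * Px p + snd h * Py p)) (at p)"
    and Q: "\<And>p. p \<in> cball 0 R \<Longrightarrow> (Q has_derivative (\<lambda>h. fst h * Qx p + snd h * Qy p)) (at p)"
    and lip: "\<And>g p q. g \<in> {Px, Py, Qy} \<Longrightarrow> p \<in> cball 0 R \<Longrightarrow> q \<in> cball 0 R \<Longrightarrow> \<bar>g p - g q\<bar> \<le> L * norm (p - q)"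
    and zero: "Py 0 = 0" "Qy 0 = 0" "P 0 = 0"
    and Py: "\<And>p. p \<in> cball 0 R \<Longrightarrow> \<bar>Py p\<bar> \<le> 1/2"
    and F: "F 0 = 0" "isCont F 0" "\<forall>\<^sub>F x in nhds 0. F x + P (x, F x) = 0"
    and f: "\<And>\<eta>. 0 < \<eta> \<Longrightarrow> \<forall>\<^sub>F x in nhds 0. \<bar>Q (x, F x) - a * x ^ (2 * n - 1)\<bar> \<le> \<eta> * \<bar>x\<bar> ^ (2 * n - 1)"
    and \<Phi>: "\<And>\<eta>. 0 < \<eta> \<Longrightarrow> \<forall>\<^sub>F x in nhds 0. \<bar>Px (x, F x) + Qy (x, F x) - b * x ^ (n - 1)\<bar> \<le> \<eta> * \<bar>x\<bar> ^ (n - 1)"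
  obtains \<rho> and V :: "real \<times> real \<Rightarrow> real" and V' W where "0 < \<rho>" "\<rho> \<le> R" "V 0 = 0"
    "\<forall>p\<in>cball 0 \<rho>. (V has_derivative V' p) (at p)"
    "\<forall>p\<in>cball 0 \<rho> - {0}. 0 < V p"
    "continuous_on (cball 0 \<rho>) W" "\<forall>p\<in>cball 0 \<rho> - {0}. 0 < W p"
    "\<forall>p\<in>cball 0 \<rho>. V' p (- sgn b *\<^sub>R X p) \<le> - W p"
proof -
  \<comment> \<open>Oddness of \<open>n\<close> enters here: \<open>j = n - 1\<close> is even, so
    \<open>c = x^(n-1)\<close> is nonnegative.\<close>
  obtain j where n: "n = Suc j" and "even j" using \<open>odd n\<close> by (cases n) auto
  have L12: "0 \<le> 12 * L" and n0: "0 < n" using \<open>0 < L\<close> n by simp_all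
  obtain \<epsilon> K \<eta> \<kappa> m :: real where "0 < \<eta>" "0 < \<kappa>" "0 < m" and est:
    "\<forall>x u c E. \<bar>x::real\<bar> \<le> m \<longrightarrow> 0 \<le> c \<longrightarrow> \<bar>E\<bar> \<le> \<eta> * (\<bar>x\<bar> * c\<^sup>2 + c * \<bar>u\<bar>) + 12 * L * u\<^sup>2 \<longrightarrow>
       \<kappa> * (x\<^sup>2 * c ^ 3 + c * u\<^sup>2 + \<bar>u\<bar> ^ 3) \<le>
       sgn b * (u * (a * x * c\<^sup>2 + b * c * u + E) - a * x * c\<^sup>2 * u)
       - \<epsilon> * (real n * c * u\<^sup>2 + x * c * (a * x * c\<^sup>2 + b * c * u + E))
       + K * (u\<^sup>2 * \<bar>u\<bar> + 2 * x * \<bar>u\<bar> * (a * x * c\<^sup>2 + b * c * u + E))"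
    and pos: "\<forall>x u c. \<bar>x::real\<bar> \<le> m \<longrightarrow> u \<noteq> 0 \<or> x * c \<noteq> 0 \<longrightarrow>
       0 < u\<^sup>2 / 2 - a * (x * c)\<^sup>2 / (2 * real n) + sgn b * (K * x * (u * \<bar>u\<bar>) - \<epsilon> * (x * c) * u)"
    by (rule lyapunov_derivative_estimate[OF \<open>a < 0\<close> \<open>b \<noteq> 0\<close> L12 n0]) (rule that)
  obtain \<rho>' where \<rho>': "0 < \<rho>'" "\<rho>' \<le> R" and exp:
    "\<forall>x y u. (x, y) \<in> cball 0 \<rho>' \<longrightarrow> u = y + P (x, y) \<longrightarrow>
       \<bar>Q (x, y) + u * Px (x, y) + Q (x, y) * Py (x, y) - (a * x ^ (2 * n - 1) + b * x ^ (n - 1) * u)\<bar>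
         \<le> \<eta> * (\<bar>x\<bar> ^ (2 * n - 1) + \<bar>x\<bar> ^ (n - 1) * \<bar>u\<bar>) + 12 * L * u\<^sup>2"
    by (rule velocity_derivative_expansion[OF \<open>0 < R\<close> \<open>0 < L\<close> P Q lip zero(1,2) F f \<Phi> \<open>0 < \<eta>\<close>])
       (assumption | rule that)+
  define \<rho> where "\<rho> = min \<rho>' m"
  define u where "u p = snd p + P p" for p
  define UU where "UU p = u p * \<bar>u p\<bar>" for p
  define du where "du p h = snd h + (fst h * Px p + snd h * Py p)" for p h
  define V where "V p = (u p)\<^sup>2 / 2 - a * (fst p ^ n)\<^sup>2 / (2 * real n) +
      sgn b * (K * fst p * UU p - \<epsilon> * fst p ^ n * u p)" for p
  define V' where "V' p h = u p * du p h - a * (fst p ^ n * fst p ^ (n - 1) * fst h) +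
      sgn b * (K * (fst h * UU p + fst p * (2 * \<bar>u p\<bar> * du p h))
        - \<epsilon> * (real n * fst p ^ (n - 1) * fst h * u p + fst p ^ n * du p h))" for p h
  define W where "W p = \<kappa> * ((fst p)\<^sup>2 * (fst p ^ (n - 1)) ^ 3 + fst p ^ (n - 1) * (u p)\<^sup>2 + \<bar>u p\<bar> ^ 3)" for p
  have \<rho>: "0 < \<rho>" "\<rho> \<le> R" using \<rho>' \<open>0 < m\<close> by (auto simp: \<rho>_def)
  have inR: "p \<in> cball 0 R" if "p \<in> cball 0 \<rho>" for p :: "real \<times> real" using that \<rho> by auto
  have xm: "\<bar>fst p\<bar> \<le> m" if "p \<in> cball 0 \<rho>" for p :: "real \<times> real"
    using that norm_fst_le[of "fst p" "snd p"] by (simp add: \<rho>_def)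
  have c: "0 \<le> x ^ (n - 1)" "\<bar>x\<bar> ^ (n - 1) = x ^ (n - 1)" "x ^ n = x * x ^ (n - 1)"
    "x ^ (2 * n - 1) = x * (x ^ (n - 1))\<^sup>2" "\<bar>x\<bar> ^ (2 * n - 1) = \<bar>x\<bar> * (x ^ (n - 1))\<^sup>2" for x :: real
    using \<open>even j\<close> by (auto simp: n power_even_abs zero_le_even_power power_mult[symmetric] mult.commute)
  have dU: "(u has_derivative du p) (at p)" if "p \<in> cball 0 \<rho>" for p
    unfolding u_def[abs_def] du_def[abs_def]
    by (intro has_derivative_add has_derivative_snd has_derivative_ident P inR that)
  have dUU: "(UU has_derivative (\<lambda>h. 2 * \<bar>u p\<bar> * du p h)) (at p)" if "p \<in> cball 0 \<rho>" for p
    using has_derivative_compose[OF dU[OF that] has_real_derivative_mult_abs[unfolded has_field_derivative_def]]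
    by (simp add: UU_def[abs_def])
  \<comment> \<open>The estimates bound \<open>V\<close> and \<open>W\<close> in terms of
    \<open>x\<close> and \<open>u\<close>; definiteness at points of the plane also requires that
    these two vanish together only at the origin.\<close>
  have nondeg: "u p \<noteq> 0 \<or> fst p \<noteq> 0" if "p \<in> cball 0 \<rho>" "p \<noteq> 0" for p
  proof (cases "fst p = 0")
    case True
    then have p: "p = (0, snd p)" by (simp add: prod_eq_iff)
    have "\<bar>snd p\<bar> \<le> R" using inR[OF that(1)] norm_snd_le[of "snd p" "fst p"] by simp
    then obtain t where "1/2 \<le> t" "snd p + P (0, snd p) = t * snd p"
      using axis_velocity[OF P Py zero(3)] by blast
    moreover have "snd p \<noteq> 0" using p that(2) by (auto simp: zero_prod_def)
    ultimately have "u p \<noteq> 0" using p by (simp add: u_def)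
    then show ?thesis ..
  qed simp
  have posV: "0 < V p" if "p \<in> cball 0 \<rho>" "p \<noteq> 0" for p
    using pos[rule_format, OF xm[OF that(1)], of "u p" "fst p ^ (n - 1)"] nondeg[OF that]
    by (auto simp: V_def UU_def c(3))
  have posW: "0 < W p" if "p \<in> cball 0 \<rho>" "p \<noteq> 0" for p
  proof -
    let ?c = "fst p ^ (n - 1)"
    have nn: "0 \<le> (fst p)\<^sup>2 * ?c ^ 3" "0 \<le> ?c * (u p)\<^sup>2" "0 \<le> \<bar>u p\<bar> ^ 3"
      using c(1)[of "fst p"] by simp_all
    have "0 < (fst p)\<^sup>2 * ?c ^ 3 \<or> 0 < \<bar>u p\<bar> ^ 3"
    proof (cases "u p = 0")
      case True
      then have "fst p \<noteq> 0" using nondeg[OF that] by simp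
      then have "0 < ?c" using c(1)[of "fst p"] by (simp add: order_less_le)
      then show ?thesis using \<open>fst p \<noteq> 0\<close> by simp
    qed simp
    then have "0 < (fst p)\<^sup>2 * ?c ^ 3 + ?c * (u p)\<^sup>2 + \<bar>u p\<bar> ^ 3" using nn by linarith
    then show ?thesis using \<open>0 < \<kappa>\<close> by (simp add: W_def)
  qed
  have contu: "continuous_on (cball 0 \<rho>) u"
    using dU by (meson continuous_at_imp_continuous_on has_derivative_continuous)
  have decr: "V' p (- sgn b *\<^sub>R X p) \<le> - W p" if p: "p \<in> cball 0 \<rho>" for p
  proof -
    define x where "x = fst p"
    define c where "c = x ^ (n - 1)"
    define z where "z = u p"
    define U where "U = Q p + z * Px p + Q p * Py p"
    define E where "E = U - (a * x * c\<^sup>2 + b * c * z)"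
    have pxy: "p = (x, snd p)" by (simp add: x_def)
    have "\<bar>U - (a * x ^ (2 * n - 1) + b * x ^ (n - 1) * z)\<bar>
         \<le> \<eta> * (\<bar>x\<bar> ^ (2 * n - 1) + \<bar>x\<bar> ^ (n - 1) * \<bar>z\<bar>) + 12 * L * z\<^sup>2"
      using exp[rule_format, of x "snd p" z] p unfolding pxy[symmetric] by (simp add: \<rho>_def z_def u_def U_def)
    then have E: "\<bar>E\<bar> \<le> \<eta> * (\<bar>x\<bar> * c\<^sup>2 + c * \<bar>z\<bar>) + 12 * L * z\<^sup>2"
      by (simp only: E_def c_def c(2,4,5) mult.assoc)
    have "\<bar>x\<bar> \<le> m" using xm[OF p] by (simp add: x_def)
    moreover have "0 \<le> c" unfolding c_def by (rule c(1))
    ultimately have "\<bar>x\<bar> \<le> m" "0 \<le> c" by blast+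
    from est[rule_format, OF this E] have est': "W p \<le> sgn b * (z * U - a * x * c\<^sup>2 * z)
       - \<epsilon> * (real n * c * z\<^sup>2 + x * c * U) + K * (z\<^sup>2 * \<bar>z\<bar> + 2 * x * \<bar>z\<bar> * U)"
      by (simp add: E_def W_def c_def x_def z_def)
    \<comment> \<open>In \<open>V\<close> the sign stands only before the correction terms. Moving
      along \<open>- s *\<^sub>R X\<close> gives the energy rate the factor \<open>- s\<close> and
      the corrections the factor \<open>- s * s = - 1\<close>, exactly minus the expression bounded
      below by the estimate.\<close>
    define s where "s = sgn b"
    have s: "s * s = 1" using \<open>b \<noteq> 0\<close> by (simp add: s_def sgn_mult_self_eq)
    have h: "fst (- s *\<^sub>R X p) = - s * z" "du p (- s *\<^sub>R X p) = - s * U"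
      by (simp_all add: X_def nilpotent_system_def du_def split_beta u_def z_def U_def algebra_simps)
    have "V' p (- s *\<^sub>R X p) = - s * (z * U - a * x * c\<^sup>2 * z)
       + s * s * (\<epsilon> * (real n * c * z\<^sup>2 + x * c * U) - K * (z\<^sup>2 * \<bar>z\<bar> + 2 * x * \<bar>z\<bar> * U))"
      unfolding V'_def h s_def[symmetric] x_def[symmetric] z_def[symmetric] UU_def c(3) c_def[symmetric]
      by (simp add: algebra_simps power2_eq_square)
    then show ?thesis using est' \<open>b \<noteq> 0\<close> unfolding s s_def by simp
  qed
  show thesis
  proof (rule that[of \<rho> V V' W])
    show "V 0 = 0" using zero(3) n by (simp add: V_def u_def UU_def)
    show "\<forall>p\<in>cball 0 \<rho>. (V has_derivative V' p) (at p)"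
    proof
      fix p :: "real \<times> real" assume p: "p \<in> cball 0 \<rho>"
      have dn: "((\<lambda>p. fst p ^ n) has_derivative (\<lambda>h. real n * fst p ^ (n - 1) * fst h)) (at p)"
        by (auto intro!: derivative_eq_intros simp: fun_eq_iff)
      have d1: "((\<lambda>p. (u p)\<^sup>2 / 2) has_derivative (\<lambda>h. u p * du p h)) (at p)"
        by (rule has_derivative_eq_rhs, (rule derivative_intros dU[OF p])+) (auto simp: fun_eq_iff)
      have d2: "((\<lambda>p. a * (fst p ^ n)\<^sup>2 / (2 * real n)) has_derivative
          (\<lambda>h. a * (fst p ^ n * fst p ^ (n - 1) * fst h))) (at p)"
        by (rule has_derivative_eq_rhs, (rule derivative_intros dn)+)
           (use n0 in \<open>auto simp: fun_eq_iff field_simps\<close>)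
      have d3: "((\<lambda>p. K * fst p * UU p) has_derivative
          (\<lambda>h. K * (fst h * UU p + fst p * (2 * \<bar>u p\<bar> * du p h)))) (at p)"
        by (rule has_derivative_eq_rhs, (rule derivative_intros dUU[OF p])+)
           (auto simp: fun_eq_iff algebra_simps)
      have d4: "((\<lambda>p. \<epsilon> * fst p ^ n * u p) has_derivative
          (\<lambda>h. \<epsilon> * (real n * fst p ^ (n - 1) * fst h * u p + fst p ^ n * du p h))) (at p)"
        by (rule has_derivative_eq_rhs, (rule dn dU[OF p] derivative_intros)+)
           (auto simp: fun_eq_iff algebra_simps)
      show "(V has_derivative V' p) (at p)"
        unfolding V_def[abs_def] V'_def[abs_def]
        by (intro has_derivative_add has_derivative_diff has_derivative_mult_right d1 d2 d3 d4)
    qed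
    show "continuous_on (cball 0 \<rho>) W"
      unfolding W_def by (intro continuous_intros contu)
  qed (use \<rho> posV posW decr in auto)
qed

section \<open>Jets, leading terms and regularity\<close>

lemma Ck_on_imp_continuous_on: "Ck_on k f S \<Longrightarrow> continuous_on S f"
  by (cases k) (auto intro: differentiable_imp_continuous_within continuous_at_imp_continuous_on)

text \<open>The last conclusion ties the scalar partial derivatives to
  \<open>frechet_derivative\<close>, through which the vanishing 1-jets give their values at the
  origin.\<close>

lemma Ck_on_Suc_partials:
  fixes f :: "real \<times> real \<Rightarrow> real"
  assumes "Ck_on (Suc k) f U"
  obtains fx fy where "Ck_on k fx U" "Ck_on k fy U"
    "\<forall>p\<in>U. (f has_derivative (\<lambda>h. fst h * fx p + snd h * fy p)) (at p)"
    "\<forall>p\<in>U. fx p = frechet_derivative f (at p) (1, 0) \<and> fy p = frechet_derivative f (at p) (0, 1)"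
proof -
  let ?D = "\<lambda>p. frechet_derivative f (at p)"
  have D: "?D p = (\<lambda>h. fst h * ?D p (1, 0) + snd h * ?D p (0, 1))" if "p \<in> U" for p
  proof
    fix h :: "real \<times> real"
    have "f differentiable (at p)" using assms that by simp
    then have "linear (?D p)" by (rule linear_frechet_derivative)
    then have "?D p (fst h *\<^sub>R (1, 0) + snd h *\<^sub>R (0, 1)) = fst h * ?D p (1, 0) + snd h * ?D p (0, 1)"
      by (simp only: linear_add linear_scale real_scaleR_def)
    moreover have "fst h *\<^sub>R (1, 0) + snd h *\<^sub>R (0, 1) = h" by (simp add: prod_eq_iff)
    ultimately show "?D p h = fst h * ?D p (1, 0) + snd h * ?D p (0, 1)" by (simp only:)
  qed
  show thesis
  proof (rule that[of "\<lambda>p. ?D p (1, 0)" "\<lambda>p. ?D p (0, 1)"])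
    show "\<forall>p\<in>U. (f has_derivative (\<lambda>h. fst h * ?D p (1, 0) + snd h * ?D p (0, 1))) (at p)"
    proof
      fix p assume p: "p \<in> U"
      then have "(f has_derivative ?D p) (at p)"
        using assms by (simp add: frechet_derivative_works)
      then show "(f has_derivative (\<lambda>h. fst h * ?D p (1, 0) + snd h * ?D p (0, 1))) (at p)"
        by (subst D[OF p, symmetric])
    qed
  qed (use assms in auto)
qed

text \<open>The partial derivatives are bounded on the compact ball, and the ball is convex. For
  \<open>P\<close> and \<open>Q\<close> this yields uniqueness of orbits, for their partial
  derivatives the quadratic remainder in \<open>u\<close>.\<close>

lemma Ck_on_Suc_lipschitz:
  fixes f :: "real \<times> real \<Rightarrow> real"
  assumes "Ck_on (Suc k) f U" "cball 0 R \<subseteq> U"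
  shows "\<exists>L. \<forall>p\<in>cball 0 R. \<forall>q\<in>cball 0 R. \<bar>f p - f q\<bar> \<le> L * norm (p - q)"
proof -
  obtain fx fy where C: "Ck_on k fx U" "Ck_on k fy U"
    and D: "\<forall>p\<in>U. (f has_derivative (\<lambda>h. fst h * fx p + snd h * fy p)) (at p)"
    by (rule Ck_on_Suc_partials[OF assms(1)]) (rule that)
  have "\<exists>B. \<forall>p\<in>cball 0 R. \<bar>g p\<bar> \<le> B" if "Ck_on k g U" for g :: "real \<times> real \<Rightarrow> real"
  proof -
    have "continuous_on (cball 0 R) g"
      using Ck_on_imp_continuous_on[OF that] assms(2) by (rule continuous_on_subset)
    then have "bounded (g ` cball 0 R)"
      using compact_cball by (intro compact_imp_bounded compact_continuous_image)
    then show ?thesis by (auto simp: bounded_iff)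
  qed
  from this[OF C(1)] this[OF C(2)] obtain A B where
    A: "\<And>p. p \<in> cball 0 R \<Longrightarrow> \<bar>fx p\<bar> \<le> A" and B: "\<And>p. p \<in> cball 0 R \<Longrightarrow> \<bar>fy p\<bar> \<le> B" by blast
  have "norm (f p - f q) \<le> (A + B) * norm (p - q)" if "p \<in> cball 0 R" "q \<in> cball 0 R" for p q
  proof (rule differentiable_bound[OF convex_cball _ _ that])
    fix p :: "real \<times> real" assume p: "p \<in> cball 0 R"
    then show "(f has_derivative (\<lambda>h. fst h * fx p + snd h * fy p)) (at p within cball 0 R)"
      using D assms(2) by (blast intro: has_derivative_at_withinI)
    show "onorm (\<lambda>h. fst h * fx p + snd h * fy p) \<le> A + B"
    proof (rule onorm_le)
      fix h :: "real \<times> real"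
      have "\<bar>fst h * fx p\<bar> \<le> norm h * A"
        unfolding abs_mult using A[OF p] norm_fst_le[of "fst h" "snd h"] by (intro mult_mono) auto
      moreover have "\<bar>snd h * fy p\<bar> \<le> norm h * B"
        unfolding abs_mult using B[OF p] norm_snd_le[of "snd h" "fst h"] by (intro mult_mono) auto
      ultimately show "norm (fst h * fx p + snd h * fy p) \<le> (A + B) * norm h"
        by (simp add: algebra_simps)
    qed
  qed
  then show ?thesis by (intro exI[of _ "A + B"]) auto
qed

text \<open>The 1-jet is the value plus the linear part; the increment 0 isolates the value.\<close>

lemma jet_1_eq_0D:
  assumes "jet 1 f p = (\<lambda>_. 0)" "f differentiable (at p)"
  shows "f p = 0" "frechet_derivative f (at p) v = 0"
proof -
  have j: "f p + frechet_derivative f (at p) v = 0" for v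
    using fun_cong[OF assms(1), of v] by (simp add: jet_def)
  have "frechet_derivative f (at p) 0 = 0"
    using linear_frechet_derivative[OF assms(2)] by (rule linear_0)
  with j[of 0] show "f p = 0" by simp
  with j[of v] show "frechet_derivative f (at p) v = 0" by simp
qed

text \<open>\<open>leading_term\<close> says nothing at the point 0 itself. Passing from
  \<open>at 0\<close> to \<open>nhds 0\<close> requires both sides to vanish there, which is the
  purpose of \<open>g 0 = 0\<close> and \<open>0 < k\<close>.\<close>

lemma leading_term_eventually:
  assumes "leading_term g c k" "g 0 = 0" "0 < k" "0 < \<eta>"
  shows "\<forall>\<^sub>F x in nhds 0. \<bar>g x - c * x ^ k\<bar> \<le> \<eta> * \<bar>x\<bar> ^ k"
proof -
  obtain B where "0 < B" and B: "\<forall>\<^sub>F x in at 0. norm (g x - c * x ^ k) \<le> B * norm (x ^ (k + 1))"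
    using assms(1) unfolding leading_term_def by (auto elim!: landau_o.bigE)
  have "\<forall>\<^sub>F x in at (0::real). \<bar>x\<bar> < \<eta> / B"
    using \<open>0 < \<eta>\<close> \<open>0 < B\<close> by (auto simp: eventually_at dist_real_def intro!: exI[of _ "\<eta> / B"])
  with B have "\<forall>\<^sub>F x in at 0. \<bar>g x - c * x ^ k\<bar> \<le> \<eta> * \<bar>x\<bar> ^ k"
  proof eventually_elim
    case (elim x)
    have "B * \<bar>x\<bar> \<le> \<eta>" using elim(2) \<open>0 < B\<close> by (simp add: pos_less_divide_eq mult.commute)
    then have "(B * \<bar>x\<bar>) * \<bar>x\<bar> ^ k \<le> \<eta> * \<bar>x\<bar> ^ k" by (rule mult_right_mono) simp
    with elim(1) show ?case by (simp add: abs_mult power_abs mult.assoc)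
  qed
  then show ?thesis
    using assms(2,3) by (auto simp: eventually_at_filter zero_power elim!: eventually_mono)
qed

text \<open>The case of exponent 0, which serves to exclude \<open>n = 1\<close>.\<close>

lemma leading_term_0_limit:
  assumes "leading_term g c 0"
  shows "(g \<longlongrightarrow> c) (at 0)"
proof -
  obtain B where B: "\<forall>\<^sub>F x in at 0. norm (g x - c) \<le> B * norm (x::real)"
    using assms unfolding leading_term_def by (auto elim!: landau_o.bigE)
  have "((\<lambda>x::real. B * norm x) \<longlongrightarrow> 0) (at 0)" by (auto intro!: tendsto_eq_intros)
  with B have "((\<lambda>x. g x - c) \<longlongrightarrow> 0) (at 0)" by (rule Lim_null_comparison)
  then show ?thesis by (simp add: LIM_zero_iff)
qed

section \<open>Nilpotent foci\<close>

theorem theorem14: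
  fixes P Q :: "real \<times> real \<Rightarrow> real" and U :: "(real \<times> real) set"
    and F :: "real \<Rightarrow> real" and a b :: real and n r \<alpha> \<beta> :: nat
  assumes "odd n" and "n > 0" and "r \<ge> 3" and "2 * n - 1 < r"
    and "open U" and "0 \<in> U" and "Ck_on r P U" and "Ck_on r Q U"
    and "jet 1 P 0 = (\<lambda>_. 0)" and "jet 1 Q 0 = (\<lambda>_. 0)"
    and "isolated_singular_point (nilpotent_system P Q) 0"
    and "nilpotent_singular_point (nilpotent_system P Q) 0"
    and "monodromic (nilpotent_system P Q) U 0"
    and "nullcline_branch P F"
    and "leading_term (andreev_f Q F) a \<alpha>" and "a < 0" and "\<alpha> = 2 * n - 1"
    and "leading_term (andreev_Phi P Q F) b \<beta>"
    and "\<beta> = n - 1" and "b\<^sup>2 + 4 * a * real n < 0"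
  shows "nilpotent_focus (nilpotent_system P Q) U 0"
proof -
  define X where "X = nilpotent_system P Q"
  \<comment> \<open>Two derivatives are split off: the first partial derivatives are then still of
    class at least \<open>C^1\<close>, hence Lipschitz near the origin.\<close>
  define k where "k = r - 2"
  have r: "r = Suc (Suc k)" using \<open>r \<ge> 3\<close> by (simp add: k_def)
  have CP: "Ck_on (Suc (Suc k)) P U" and CQ: "Ck_on (Suc (Suc k)) Q U" using assms r by simp_all
  obtain Px Py where CPx: "Ck_on (Suc k) Px U" and CPy: "Ck_on (Suc k) Py U"
    and dP: "\<forall>p\<in>U. (P has_derivative (\<lambda>h. fst h * Px p + snd h * Py p)) (at p)"
    and fP: "\<forall>p\<in>U. Px p = frechet_derivative P (at p) (1, 0) \<and> Py p = frechet_derivative P (at p) (0, 1)"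
    by (rule Ck_on_Suc_partials[OF CP]) (rule that)
  obtain Qx Qy where CQy: "Ck_on (Suc k) Qy U"
    and dQ: "\<forall>p\<in>U. (Q has_derivative (\<lambda>h. fst h * Qx p + snd h * Qy p)) (at p)"
    and fQ: "\<forall>p\<in>U. Qx p = frechet_derivative Q (at p) (1, 0) \<and> Qy p = frechet_derivative Q (at p) (0, 1)"
    by (rule Ck_on_Suc_partials[OF CQ]) (rule that)
  have "P differentiable (at 0)" "Q differentiable (at 0)"
    using dP dQ \<open>0 \<in> U\<close> unfolding differentiable_def by blast+
  then have zero: "P 0 = 0" "Q 0 = 0" "Px 0 = 0" "Py 0 = 0" "Qy 0 = 0"
    using fP fQ \<open>0 \<in> U\<close> jet_1_eq_0D[OF \<open>jet 1 P 0 = _\<close>] jet_1_eq_0D[OF \<open>jet 1 Q 0 = _\<close>] by simp_all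
  have "\<exists>R>0. cball 0 R \<subseteq> U" using \<open>open U\<close> \<open>0 \<in> U\<close> open_contains_cball by blast
  then obtain R0 where R0: "0 < R0" "cball 0 R0 \<subseteq> U" by blast
  obtain LP LQ L1 L2 L3 where L: "\<forall>p\<in>cball 0 R0. \<forall>q\<in>cball 0 R0. \<bar>P p - P q\<bar> \<le> LP * norm (p - q)"
    "\<forall>p\<in>cball 0 R0. \<forall>q\<in>cball 0 R0. \<bar>Q p - Q q\<bar> \<le> LQ * norm (p - q)"
    "\<forall>p\<in>cball 0 R0. \<forall>q\<in>cball 0 R0. \<bar>Px p - Px q\<bar> \<le> L1 * norm (p - q)"
    "\<forall>p\<in>cball 0 R0. \<forall>q\<in>cball 0 R0. \<bar>Py p - Py q\<bar> \<le> L2 * norm (p - q)"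
    "\<forall>p\<in>cball 0 R0. \<forall>q\<in>cball 0 R0. \<bar>Qy p - Qy q\<bar> \<le> L3 * norm (p - q)"
    using Ck_on_Suc_lipschitz[OF CP R0(2)] Ck_on_Suc_lipschitz[OF CQ R0(2)] Ck_on_Suc_lipschitz[OF CPx R0(2)]
      Ck_on_Suc_lipschitz[OF CPy R0(2)] Ck_on_Suc_lipschitz[OF CQy R0(2)]
    by (elim exE) (rule that)
  define L where "L = Max {1, LP, LQ, L1, L2, L3}"
  have L_ge: "1 \<le> L" "LP \<le> L" "LQ \<le> L" "L1 \<le> L" "L2 \<le> L" "L3 \<le> L"
    unfolding L_def by (intro Max_ge; simp)+
  then have "0 < L" by linarith
  \<comment> \<open>Since \<open>Py\<close> vanishes at 0 with Lipschitz constant \<open>L\<close>,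
    the radius \<open>1 / (2 * L)\<close> forces \<open>|Py| \<le> 1/2\<close>.\<close>
  define R where "R = min R0 (1 / (2 * L))"
  have R: "0 < R" "R \<le> R0" "cball 0 R \<subseteq> cball (0 :: real \<times> real) R0" "cball 0 R \<subseteq> U"
    using R0 \<open>0 < L\<close> by (auto simp: R_def)
  have lip: "\<bar>g p - g q\<bar> \<le> L * norm (p - q)"
    if "g \<in> {P, Q, Px, Py, Qy}" "p \<in> cball 0 R" "q \<in> cball 0 R" for g p q
  proof -
    have pq: "p \<in> cball 0 R0" "q \<in> cball 0 R0" using that R(3) by blast+
    have "\<exists>M\<le>L. \<bar>g p - g q\<bar> \<le> M * norm (p - q)"
      using that(1) L_ge L[THEN bspec, OF pq(1), THEN bspec, OF pq(2)] by (elim insertE emptyE) auto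
    then obtain M where "M \<le> L" "\<bar>g p - g q\<bar> \<le> M * norm (p - q)" by blast
    with mult_right_mono[OF \<open>M \<le> L\<close> norm_ge_zero[of "p - q"]] show ?thesis by linarith
  qed
  have dP': "(P has_derivative (\<lambda>h. fst h * Px p + snd h * Py p)) (at p)"
    and dQ': "(Q has_derivative (\<lambda>h. fst h * Qx p + snd h * Qy p)) (at p)" if "p \<in> cball 0 R" for p
    using dP dQ R(4) that by blast+
  have Py: "\<bar>Py p\<bar> \<le> 1/2" if "p \<in> cball 0 R" for p
  proof -
    have "\<bar>Py p - Py 0\<bar> \<le> L * norm (p - 0)" using that R(1) by (intro lip) auto
    also have "\<dots> \<le> L * (1 / (2 * L))"
      using that \<open>0 < L\<close> by (intro mult_left_mono) (auto simp: R_def)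
    finally show ?thesis using zero \<open>0 < L\<close> by simp
  qed
  have F: "F 0 = 0" "isCont F 0" "\<forall>\<^sub>F x in nhds 0. F x + P (x, F x) = 0"
    using \<open>nullcline_branch P F\<close> by (auto simp: nullcline_branch_def)
  have contG: "isCont (\<lambda>x. (x, F x)) 0" using F(2) by (intro continuous_intros)
  then have "((\<lambda>x. (x, F x)) \<longlongrightarrow> (0, F 0)) (nhds 0)"
    by (simp add: isCont_def tendsto_nhds_iff)
  moreover have "(0, F 0) \<in> U" using \<open>0 \<in> U\<close> F(1) by (simp add: zero_prod_def)
  ultimately have "\<forall>\<^sub>F x in nhds 0. (x, F x) \<in> U"
    using \<open>open U\<close> topological_tendstoD by blast
  \<comment> \<open>\<open>andreev_Phi\<close> uses one-variable derivatives; they are partial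
    derivatives only where \<open>(x, F x)\<close> lies in the open set \<open>U\<close>, which
    holds near 0 by continuity of \<open>F\<close>.\<close>
  then have \<Phi>_eq: "\<forall>\<^sub>F x in nhds 0. andreev_Phi P Q F x = Px (x, F x) + Qy (x, F x)"
  proof eventually_elim
    case (elim x)
    have "((\<lambda>s. (s, F x)) has_derivative (\<lambda>h. (h, 0))) (at x)"
      by (auto intro!: derivative_eq_intros)
    from has_derivative_compose[OF this bspec[OF dP elim]]
    have "((\<lambda>s. P (s, F x)) has_real_derivative Px (x, F x)) (at x)"
      by (simp add: has_field_derivative_def mult_commute_abs)
    moreover have "((\<lambda>s. (x, s)) has_derivative (\<lambda>h. (0, h))) (at (F x))"
      by (auto intro!: derivative_eq_intros)
    from has_derivative_compose[OF this bspec[OF dQ elim]]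
    have "((\<lambda>s. Q (x, s)) has_real_derivative Qy (x, F x)) (at (F x))"
      by (simp add: has_field_derivative_def mult_commute_abs)
    ultimately show ?case by (simp add: andreev_Phi_def DERIV_imp_deriv)
  qed
  then have \<Phi>0: "andreev_Phi P Q F 0 = 0"
    using eventually_nhds_x_imp_x[OF \<Phi>_eq] zero F(1) by (simp add: zero_prod_def)
  \<comment> \<open>For \<open>n = 1\<close> the exponent of \<open>\<Phi>\<close> would be 0, so
    \<open>\<Phi>\<close> would tend to \<open>b\<close>; by continuity of the partial derivatives
    it tends to 0.\<close>
  have "n \<noteq> 1"
  proof
    assume "n = 1"
    then have "leading_term (andreev_Phi P Q F) b 0" using assms by simp
    then have lim_b: "(andreev_Phi P Q F \<longlongrightarrow> b) (at 0)" by (rule leading_term_0_limit)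
    have cont0: "isCont g 0" if "Ck_on (Suc k) g U" for g :: "real \<times> real \<Rightarrow> real"
      using Ck_on_imp_continuous_on[OF that] \<open>open U\<close> \<open>0 \<in> U\<close> by (simp add: continuous_on_eq_continuous_at)
    have "isCont (\<lambda>x. Px (x, F x) + Qy (x, F x)) 0"
      using cont0[OF CPx] cont0[OF CQy] F(1)
      by (intro continuous_add isCont_o2[OF contG]) (simp_all add: zero_prod_def)
    then have "((\<lambda>x. Px (x, F x) + Qy (x, F x)) \<longlongrightarrow> 0) (at 0)"
      using zero F(1) by (simp add: isCont_def zero_prod_def)
    moreover have "\<forall>\<^sub>F x in at 0. Px (x, F x) + Qy (x, F x) = andreev_Phi P Q F x"
      using \<Phi>_eq by (auto simp: eventually_at_filter elim: eventually_mono)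
    ultimately have "(andreev_Phi P Q F \<longlongrightarrow> 0) (at 0)" by (rule Lim_transform_eventually)
    with lim_b have "b = 0" using tendsto_unique[OF at_neq_bot] by blast
    then show False using assms(18) by (simp add: leading_term_def)
  qed
  then have n: "0 < n - 1" "0 < 2 * n - 1" using \<open>n > 0\<close> by auto
  have f: "\<forall>\<^sub>F x in nhds 0. \<bar>Q (x, F x) - a * x ^ (2 * n - 1)\<bar> \<le> \<eta> * \<bar>x\<bar> ^ (2 * n - 1)" if "0 < \<eta>" for \<eta>
    using leading_term_eventually[of "andreev_f Q F" a "2 * n - 1" \<eta>] assms(15,17) n that zero F(1)
    by (simp add: andreev_f_def zero_prod_def)
  have \<Phi>: "\<forall>\<^sub>F x in nhds 0. \<bar>Px (x, F x) + Qy (x, F x) - b * x ^ (n - 1)\<bar> \<le> \<eta> * \<bar>x\<bar> ^ (n - 1)" if "0 < \<eta>" for \<eta>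
  proof -
    have "\<forall>\<^sub>F x in nhds 0. \<bar>andreev_Phi P Q F x - b * x ^ (n - 1)\<bar> \<le> \<eta> * \<bar>x\<bar> ^ (n - 1)"
      using assms(18,19) \<Phi>0 n(1) that by (intro leading_term_eventually) simp_all
    with \<Phi>_eq show ?thesis by eventually_elim simp
  qed
  have "b \<noteq> 0" using assms(18) by (simp add: leading_term_def)
  have lip3: "\<bar>g p - g q\<bar> \<le> L * norm (p - q)"
    if "g \<in> {Px, Py, Qy}" "p \<in> cball 0 R" "q \<in> cball 0 R" for g p q
    using that by (intro lip) auto
  obtain \<rho> and V :: "real \<times> real \<Rightarrow> real" and V' W where \<rho>: "0 < \<rho>" "\<rho> \<le> R" and V0: "V 0 = 0"
    and V: "\<forall>p\<in>cball 0 \<rho>. (V has_derivative V' p) (at p)"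
    and posV: "\<forall>p\<in>cball 0 \<rho> - {0}. 0 < V p"
    and contW: "continuous_on (cball 0 \<rho>) W" and posW: "\<forall>p\<in>cball 0 \<rho> - {0}. 0 < W p"
    and decr: "\<forall>p\<in>cball 0 \<rho>. V' p (- sgn b *\<^sub>R X p) \<le> - W p"
    unfolding X_def
    by (rule nilpotent_lyapunov_function[OF R(1) \<open>0 < L\<close> \<open>odd n\<close> \<open>a < 0\<close> \<open>b \<noteq> 0\<close> dP' dQ' lip3
          zero(4,5,1) Py F f \<Phi>]) (assumption | rule that)+
  have X0: "X 0 = 0" using zero by (simp add: X_def nilpotent_system_def zero_prod_def)
  have sub: "cball 0 \<rho> \<subseteq> cball (0 :: real \<times> real) R" using \<rho> by auto
  have lipX: "norm (X p - X q) \<le> (1 + 2 * L) * norm (p - q)"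
    if "p \<in> cball 0 \<rho>" "q \<in> cball 0 \<rho>" for p q
  proof -
    have pq: "p \<in> cball 0 R" "q \<in> cball 0 R" using that sub by auto
    have "X p - X q = (snd (p - q) + (P p - P q), Q p - Q q)"
      by (simp add: X_def nilpotent_system_def split_beta)
    then have "norm (X p - X q) \<le> \<bar>snd (p - q) + (P p - P q)\<bar> + \<bar>Q p - Q q\<bar>"
      using norm_Pair_le[of "snd (p - q) + (P p - P q)" "Q p - Q q"] by simp
    also have "\<dots> \<le> \<bar>snd (p - q)\<bar> + \<bar>P p - P q\<bar> + \<bar>Q p - Q q\<bar>" by linarith
    also have "\<dots> \<le> norm (p - q) + L * norm (p - q) + L * norm (p - q)"
    proof (intro add_mono)
      show "\<bar>snd (p - q)\<bar> \<le> norm (p - q)"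
        using norm_snd_le[of "snd (p - q)" "fst (p - q)"] unfolding prod.collapse real_norm_def .
    qed (use lip[OF _ pq] in auto)
    finally show ?thesis by (simp add: algebra_simps)
  qed
  \<comment> \<open>The time direction in which \<open>V\<close> decreases: forward for
    \<open>b < 0\<close>, backward for \<open>b > 0\<close>. The two cases become the two
    alternatives of \<open>is_focus\<close>.\<close>
  define c where "c = - sgn b"
  have c: "c = 1 \<or> c = -1" using \<open>b \<noteq> 0\<close> by (auto simp: c_def sgn_if)
  have lipc: "norm (c *\<^sub>R X p - c *\<^sub>R X q) \<le> (1 + 2 * L) * norm (p - q)"
    if "p \<in> cball 0 \<rho>" "q \<in> cball 0 \<rho>" for p q
    using lipX[OF that] c by (auto simp: norm_minus_commute)
  have cross: "0 < fst (X (0, y))" if y: "0 < y" "y \<le> \<rho>" for y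
  proof -
    have "\<bar>y\<bar> \<le> R" using y \<rho> by simp
    then obtain t where "1/2 \<le> t" "y + P (0, y) = t * y"
      using axis_velocity[OF dP' Py zero(1)] by blast
    then show ?thesis using y by (simp add: X_def nilpotent_system_def)
  qed
  have "\<exists>\<delta>>0. \<forall>p\<in>ball 0 \<delta>. \<exists>\<gamma>. \<gamma> 0 = p \<and> (\<gamma> \<longlongrightarrow> 0) at_top \<and>
      (\<forall>t\<ge>0. \<gamma> t \<in> cball 0 \<rho> \<and> (\<gamma> has_vector_derivative c *\<^sub>R X (\<gamma> t)) (at t within {0..}))"
  proof (rule lyapunov_asymptotically_stable[where Y = "\<lambda>p. c *\<^sub>R X p" and R = \<rho> and L = "1 + 2 * L"
        and V = V and V' = V' and W = W])
    show "V' p (c *\<^sub>R X p) \<le> - W p" if "p \<in> cball 0 \<rho>" "p \<noteq> 0" for p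
      using decr that(1) by (simp add: c_def)
    show "norm (c *\<^sub>R X p - c *\<^sub>R X q) \<le> (1 + 2 * L) * norm (p - q)"
      if "p \<in> cball 0 \<rho>" "q \<in> cball 0 \<rho>" for p q by (rule lipc[OF that])
    show "(V has_derivative V' p) (at p)" if "p \<in> cball 0 \<rho>" for p using V that by blast
    show "0 < V p" "0 < W p" if "p \<in> cball 0 \<rho>" "p \<noteq> 0" for p using posV posW that by blast+
    show "0 < 1 + 2 * L" using \<open>0 < L\<close> by simp
    show "c *\<^sub>R X 0 = 0" using X0 by simp
  qed (fact \<rho>(1) V0 contW)+
  then obtain \<delta> where "0 < \<delta>" and \<delta>: "\<And>p. p \<in> ball 0 \<delta> \<Longrightarrow> \<exists>\<gamma>. \<gamma> 0 = p \<and> (\<gamma> \<longlongrightarrow> 0) at_top \<and>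
      (\<forall>t\<ge>0. \<gamma> t \<in> cball 0 \<rho> \<and> (\<gamma> has_vector_derivative c *\<^sub>R X (\<gamma> t)) (at t within {0..}))"
    by blast
  have spiral: "spirals_towards (\<lambda>q. c *\<^sub>R X q) U 0 p" if "p \<in> ball 0 \<delta> - {0}" for p
  proof -
    from that obtain \<gamma> where \<gamma>: "\<gamma> 0 = p" "(\<gamma> \<longlongrightarrow> 0) at_top"
      "\<forall>t\<ge>0. \<gamma> t \<in> cball 0 \<rho> \<and> (\<gamma> has_vector_derivative c *\<^sub>R X (\<gamma> t)) (at t within {0..})"
      using \<delta>[of p] by blast
    show ?thesis
    proof (rule spirals_towardsI[where R = \<rho> and L = "1 + 2 * L" and \<gamma> = \<gamma>])
      show "monodromic X U 0" using assms(13) by (simp add: X_def)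
      show "norm (X p - X q) \<le> (1 + 2 * L) * norm (p - q)"
        if "p \<in> cball 0 \<rho>" "q \<in> cball 0 \<rho>" for p q by (rule lipX[OF that])
      show "cball 0 \<rho> \<subseteq> U" using sub R(4) by blast
      show "0 < fst (X (0, y))" if "0 < y" "y \<le> \<rho>" for y by (rule cross[OF that])
      show "\<gamma> t \<in> cball 0 \<rho> \<and> (\<gamma> has_vector_derivative c *\<^sub>R X (\<gamma> t)) (at t within {0..})" if "0 \<le> t" for t
        using \<gamma>(3) that by simp
      show "p \<noteq> 0" using that by simp
    qed (fact \<rho>(1) X0 c \<gamma>(1) \<gamma>(2))+
  qed
  have "is_focus X U 0"
    using c
  proof
    assume "c = 1"
    then have "\<forall>p\<in>ball 0 \<delta> - {0}. spirals_towards X U 0 p" using spiral by (auto simp del: mem_ball_0)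
    then show ?thesis unfolding is_focus_def using X0 \<open>0 < \<delta>\<close> by blast
  next
    assume "c = -1"
    then have "\<forall>p\<in>ball 0 \<delta> - {0}. spirals_towards (\<lambda>q. - X q) U 0 p" using spiral by (auto simp del: mem_ball_0)
    then show ?thesis unfolding is_focus_def using X0 \<open>0 < \<delta>\<close> by blast
  qed
  then show ?thesis using assms(12) by (simp add: nilpotent_focus_def X_def)
qed

end
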